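(* Let $G$ be a finite real reflection group acting linearly on $\mathbb{R}^n$, with invariant ring $\mathbb{R}[\underline{X}]^G=\mathbb{R}[\psi_1,\ldots,\psi_n]$. Let $\theta^{(1)},\ldots,\theta^{(l)}$ be the pairwise non-isomorphic irreducible $G$-modules occurring in the coinvariant algebra $\mathbb{R}[\underline{X}]_G$, with multiplicities $\eta_1,\ldots,\eta_l$, let $(s_{1,1},\ldots,s_{1,\eta_1},s_{2,1},\ldots,s_{l,\eta_l})$ be a symmetry adapted basis of $\mathbb{R}[\underline{X}]_G$, and for each $j$ let $H^{\vartheta_j}$ be the $\eta_j\times\eta_j$ matrix with entries $$H^{\vartheta_j}_{u,v}=\mathcal{R}_G(s_{j,u}\cdot s_{j,v})\in\mathbb{R}[\psi_1,\ldots,\psi_n].$$ Then $$\Sigma\,\mathbb{R}[\underline{X}]^2\cap\mathbb{R}[\underline{X}]^G=\left\{g\in\mathbb{R}[\psi_1,\ldots,\psi_n]\;:\;g=\sum_{j=1}^l\operatorname{Tr}(H^{\vartheta_j}\cdot A_j)\right\},$$ where each $A_j\in\mathbb{R}[\psi_1,\ldots,\psi_n]^{\eta_j\times\eta_j}$ ranges over the sum of squares matrix polynomials.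
   Context: $\mathbb{R}[\underline{X}]=\mathbb{R}[X_1,\ldots,X_n]$, and $\Sigma\,\mathbb{R}[\underline{X}]^2$ is the set of finite sums of squares of polynomials. A finite real reflection group is a finite group acting linearly on $\mathbb{R}^n$ and generated by reflections; it acts on $\mathbb{R}[\underline{X}]$, and by Chevalley's theorem its invariant ring is generated by $n$ algebraically independent forms $\psi_1,\ldots,\psi_n$ (fundamental invariants). The Reynolds operator is $\mathcal{R}_G(f)=\frac{1}{|G|}\sum_{\sigma\in G}\sigma(f)$. The coinvariant algebra is $\mathbb{R}[\underline{X}]_G=\mathbb{R}[\underline{X}]/(\psi_1,\ldots,\psi_n)$; as a $G$-module it is isomorphic to the regular representation, so $\eta_j=\dim\theta^{(j)}$. For a polynomial $f$, $\langle f\rangle_G$ denotes the linear span of $\{\sigma f:\sigma\in G\}$. A symmetry adapted basis of $\mathbb{R}[\underline{X}]_G$ is a family of homogeneous polynomials $s_{j,i}\in\mathbb{R}[\underline{X}]$, $1\le j\le l$, $1\le i\le\eta_j$, such that each $\langle s_{j,i}\rangle_G$ is an irreducible $G$-module isomorphic to $\theta^{(j)}$, for every $j$ and $i$ there is a $G$-isomorphism $\langle s_{j,1}\rangle_G\to\langle s_{j,i}\rangle_G$ mapping $s_{j,1}$ to $s_{j,i}$, and the sum of all $\langle s_{j,i}\rangle_G$ is direct in $\mathbb{R}[\underline{X}]$ and maps isomorphically onto $\mathbb{R}[\underline{X}]_G$. A matrix $A\in\mathbb{R}[\psi_1,\ldots,\psi_n]^{\eta\times\eta}$ is a sum of squares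 matrix polynomial if $A=L^tL$ for some matrix $L\in\mathbb{R}[\psi_1,\ldots,\psi_n]^{m\times\eta}$ and some $m\geq 1$. *)

theory Defs
  imports
    "HOL-Analysis.Analysis"
    "HOL-Library.Poly_Mapping"
    "HOL-Algebra.QuotRing"
    "HOL-Algebra.Generated_Groups"
    "HOL-Algebra.Module"
    "Jordan_Normal_Form.Matrix"
begin

no_notation Matrix.vec_index (infixl \<open>$\<close> 100)

section \<open>Real polynomials in finitely many variables\<close>

text \<open>Variables are indexed by the finite type \<open>'n\<close>, so \<open>'n rpoly\<close> is the polynomial ring in
  \<open>CARD('n)\<close> variables: finitely supported maps from exponent vectors to coefficients, with the
  convolution product of \<^theory>\<open>HOL-Library.Poly_Mapping\<close>.\<close>

type_synonym 'n rpoly = "('n \<Rightarrow>\<^sub>0 nat) \<Rightarrow>\<^sub>0 real"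

instantiation poly_mapping :: (type, real_vector) real_vector
begin

definition scaleR_poly_mapping :: "real \<Rightarrow> ('a \<Rightarrow>\<^sub>0 'b) \<Rightarrow> ('a \<Rightarrow>\<^sub>0 'b)" where
  "scaleR_poly_mapping c f = Poly_Mapping.map (scaleR c) f"

lemma lookup_scaleR [simp]:
  fixes f :: "'a \<Rightarrow>\<^sub>0 'b::real_vector"
  shows "Poly_Mapping.lookup (c *\<^sub>R f) k = c *\<^sub>R Poly_Mapping.lookup f k"
  by (cases "Poly_Mapping.lookup f k = 0")
    (simp_all add: scaleR_poly_mapping_def Poly_Mapping.map.rep_eq)

instance
  by standard
    (rule poly_mapping_eqI, simp add: lookup_add scaleR_add_right scaleR_add_left)+

end

definition Var :: "'n \<Rightarrow> 'n rpoly" where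
  "Var i = Poly_Mapping.single (Poly_Mapping.single i 1) 1"

definition poly_subst :: "('m::finite \<Rightarrow> 'n rpoly) \<Rightarrow> 'm rpoly \<Rightarrow> 'n rpoly" where
  "poly_subst h f = (\<Sum>m\<in>Poly_Mapping.keys f.
     Poly_Mapping.lookup f m *\<^sub>R (\<Prod>i\<in>UNIV. h i ^ Poly_Mapping.lookup m i))"

definition homogeneous :: "'n::finite rpoly \<Rightarrow> bool" where
  "homogeneous f \<longleftrightarrow>
     (\<exists>d. \<forall>m\<in>Poly_Mapping.keys f. (\<Sum>i\<in>UNIV. Poly_Mapping.lookup m i) = d)"

definition algebraically_independent :: "('m::finite \<Rightarrow> 'n rpoly) \<Rightarrow> bool" where
  "algebraically_independent \<psi> \<longleftrightarrow> (\<forall>p. poly_subst \<psi> p = 0 \<longrightarrow> p = 0)"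

text \<open>The subalgebra generated by the \<open>\<psi> i\<close>.\<close>

definition generated_algebra :: "('m::finite \<Rightarrow> 'n rpoly) \<Rightarrow> 'n rpoly set" where
  "generated_algebra \<psi> = range (poly_subst \<psi>)"

definition sums_of_squares :: "'n rpoly set" where
  "sums_of_squares = {f. \<exists>(k::nat) q. f = (\<Sum>i<k. (q i)\<^sup>2)}"


section \<open>Reflection groups and their invariants\<close>

definition GL :: "(real^'n^'n) monoid" where
  "GL = \<lparr>carrier = {A. invertible A}, mult = (**), one = Finite_Cartesian_Product.mat 1\<rparr>"

text \<open>No invariant inner product is fixed, so reflections need not be orthogonal.\<close>

definition reflection :: "real^'n^'n \<Rightarrow> bool" where
  "reflection A \<longleftrightarrow> A ** A = Finite_Cartesian_Product.mat 1 \<and> dim {x. A *v x = x} = CARD('n) - 1"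

definition finite_reflection_group :: "(real^'n^'n) set \<Rightarrow> bool" where
  "finite_reflection_group G \<longleftrightarrow>
     finite G \<and> subgroup G GL \<and> generate GL {A \<in> G. reflection A} = G"

text \<open>\<open>(A f)(x) = f (A\<^sup>-\<^sup>1 x)\<close>, which is a left action of GL on polynomials.\<close>

definition poly_act :: "real^'n^'n \<Rightarrow> 'n rpoly \<Rightarrow> 'n rpoly" where
  "poly_act A = poly_subst (\<lambda>i. \<Sum>j\<in>UNIV. (matrix_inv A $ i $ j) *\<^sub>R Var j)"

definition invariants :: "(real^'n^'n) set \<Rightarrow> 'n rpoly set" where
  "invariants G = {f. \<forall>A\<in>G. poly_act A f = f}"

definition reynolds :: "(real^'n^'n) set \<Rightarrow> 'n rpoly \<Rightarrow> 'n rpoly" where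
  "reynolds G f = (1 / real (card G)) *\<^sub>R (\<Sum>A\<in>G. poly_act A f)"

text \<open>The \<open>\<psi> i\<close> are indexed by the same type as the variables: there are exactly \<open>CARD('n)\<close>.\<close>

definition fundamental_invariants :: "(real^'n^'n) set \<Rightarrow> ('n \<Rightarrow> 'n rpoly) \<Rightarrow> bool" where
  "fundamental_invariants G \<psi> \<longleftrightarrow>
     (\<forall>i. homogeneous (\<psi> i)) \<and> algebraically_independent \<psi> \<and> generated_algebra \<psi> = invariants G"


section \<open>Modules over a linear group\<close>

definition real_scalars :: "real ring" where
  "real_scalars = \<lparr>carrier = UNIV, mult = (*), one = 1, zero = 0, add = (+)\<rparr>"

text \<open>A real vector space in the sense of HOL-Algebra, together with an action. As in
  HOL-Algebra, the fields \<open>mult\<close> and \<open>one\<close> inherited from rings are ignored for modules.\<close>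

record ('g, 'v) gmodule = "(real, 'v) module" +
  act :: "'g \<Rightarrow> 'v \<Rightarrow> 'v"

definition is_gmodule :: "(real^'n^'n) set \<Rightarrow> (real^'n^'n, 'v) gmodule \<Rightarrow> bool" where
  "is_gmodule G M \<longleftrightarrow>
     Module.module real_scalars M \<and>
     (\<forall>A\<in>G. \<forall>x\<in>carrier M. act M A x \<in> carrier M) \<and>
     (\<forall>A\<in>G. \<forall>x\<in>carrier M. \<forall>y\<in>carrier M. act M A (x \<oplus>\<^bsub>M\<^esub> y) = act M A x \<oplus>\<^bsub>M\<^esub> act M A y) \<and>
     (\<forall>A\<in>G. \<forall>c. \<forall>x\<in>carrier M. act M A (c \<odot>\<^bsub>M\<^esub> x) = c \<odot>\<^bsub>M\<^esub> act M A x) \<and>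
     (\<forall>x\<in>carrier M. act M (Finite_Cartesian_Product.mat 1) x = x) \<and>
     (\<forall>A\<in>G. \<forall>B\<in>G. \<forall>x\<in>carrier M. act M (A ** B) x = act M A (act M B x))"

definition gsubmodule ::
    "(real^'n^'n) set \<Rightarrow> 'v set \<Rightarrow> (real^'n^'n, 'v) gmodule \<Rightarrow> bool" where
  "gsubmodule G N M \<longleftrightarrow> submodule N real_scalars M \<and> (\<forall>A\<in>G. \<forall>x\<in>N. act M A x \<in> N)"

definition irreducible_gmodule ::
    "(real^'n^'n) set \<Rightarrow> (real^'n^'n, 'v) gmodule \<Rightarrow> bool" where
  "irreducible_gmodule G M \<longleftrightarrow>
     is_gmodule G M \<and> carrier M \<noteq> {\<zero>\<^bsub>M\<^esub>} \<and>
     (\<forall>N. gsubmodule G N M \<longrightarrow> N = {\<zero>\<^bsub>M\<^esub>} \<or> N = carrier M)"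

definition gmodule_iso ::
    "(real^'n^'n) set \<Rightarrow> (real^'n^'n, 'v) gmodule \<Rightarrow> (real^'n^'n, 'w) gmodule \<Rightarrow> ('v \<Rightarrow> 'w) set" where
  "gmodule_iso G M N = {\<phi>. bij_betw \<phi> (carrier M) (carrier N) \<and>
     (\<forall>x\<in>carrier M. \<forall>y\<in>carrier M. \<phi> (x \<oplus>\<^bsub>M\<^esub> y) = \<phi> x \<oplus>\<^bsub>N\<^esub> \<phi> y) \<and>
     (\<forall>c. \<forall>x\<in>carrier M. \<phi> (c \<odot>\<^bsub>M\<^esub> x) = c \<odot>\<^bsub>N\<^esub> \<phi> x) \<and>
     (\<forall>A\<in>G. \<forall>x\<in>carrier M. \<phi> (act M A x) = act N A (\<phi> x))}"

definition gmodule_isomorphic ::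
    "(real^'n^'n) set \<Rightarrow> (real^'n^'n, 'v) gmodule \<Rightarrow> (real^'n^'n, 'w) gmodule \<Rightarrow> bool" where
  "gmodule_isomorphic G M N \<longleftrightarrow> gmodule_iso G M N \<noteq> {}"

text \<open>The second condition says that \<open>b 0, \<dots>, b (d - 1)\<close> is a basis.\<close>

definition has_dimension :: "('g, 'v) gmodule \<Rightarrow> nat \<Rightarrow> bool" where
  "has_dimension M d \<longleftrightarrow> (\<exists>b. b \<in> {..<d} \<rightarrow> carrier M \<and>
     bij_betw (\<lambda>c. \<Oplus>\<^bsub>M\<^esub>k\<in>{..<d}. c k \<odot>\<^bsub>M\<^esub> b k) ({..<d} \<rightarrow>\<^sub>E (UNIV :: real set)) (carrier M))"

text \<open>Indices are shifted to start at 0: here \<open>j < l\<close> and \<open>i < \<eta> j\<close>.\<close>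

definition index_set :: "nat \<Rightarrow> (nat \<Rightarrow> nat) \<Rightarrow> (nat \<times> nat) set" where
  "index_set l \<eta> = (SIGMA j:{..<l}. {..<\<eta> j})"

text \<open>The \<open>\<theta> j\<close> are, up to isomorphism and without repetition, the irreducible modules
  occurring in \<open>M\<close>, and \<open>\<eta> j\<close> is the multiplicity of \<open>\<theta> j\<close>: \<open>M\<close> is an internal direct sum
  (the addition map from the product of the summands is bijective) with exactly \<open>\<eta> j\<close>
  summands isomorphic to \<open>\<theta> j\<close>.\<close>

definition irreducible_constituents ::
    "(real^'n^'n) set \<Rightarrow> (real^'n^'n, 'v) gmodule \<Rightarrow>
     nat \<Rightarrow> (nat \<Rightarrow> (real^'n^'n, 'w) gmodule) \<Rightarrow> (nat \<Rightarrow> nat) \<Rightarrow> bool" where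
  "irreducible_constituents G M l \<theta> \<eta> \<longleftrightarrow>
     (\<forall>j<l. irreducible_gmodule G (\<theta> j)) \<and>
     (\<forall>j<l. \<forall>k<l. j \<noteq> k \<longrightarrow> \<not> gmodule_isomorphic G (\<theta> j) (\<theta> k)) \<and>
     (\<forall>j<l. \<eta> j \<ge> 1) \<and>
     (\<exists>N. (\<forall>(j, i) \<in> index_set l \<eta>.
              gsubmodule G (N (j, i)) M \<and> gmodule_isomorphic G (\<theta> j) (M\<lparr>carrier := N (j, i)\<rparr>)) \<and>
          bij_betw (\<lambda>x. \<Oplus>\<^bsub>M\<^esub>p\<in>index_set l \<eta>. x p) (\<Pi>\<^sub>E p\<in>index_set l \<eta>. N p) (carrier M))"


section \<open>The coinvariant algebra and symmetry adapted bases\<close>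

definition poly_ring :: "'n rpoly ring" where
  "poly_ring = \<lparr>carrier = UNIV, mult = (*), one = 1, zero = 0, add = (+)\<rparr>"

definition poly_gmodule :: "(real^'n^'n, 'n rpoly) gmodule" where
  "poly_gmodule = \<lparr>carrier = UNIV, mult = (*), one = 1, zero = 0, add = (+),
                   smult = scaleR, act = poly_act\<rparr>"

definition coinvariant_ideal :: "('n \<Rightarrow> 'n rpoly) \<Rightarrow> 'n rpoly set" where
  "coinvariant_ideal \<psi> = genideal poly_ring (range \<psi>)"

definition coinvariant_class :: "('n \<Rightarrow> 'n rpoly) \<Rightarrow> 'n rpoly \<Rightarrow> 'n rpoly set" where
  "coinvariant_class \<psi> f = coinvariant_ideal \<psi> +>\<^bsub>poly_ring\<^esub> f"

text \<open>A scalar \<open>c\<close> acts as multiplication by the class of the constant \<open>c\<close>. A matrix \<open>A\<close> acts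
  elementwise on residue classes: when the ideal is stable under \<open>A\<close> and its inverse, the
  image of the class of \<open>f\<close> is the class of \<open>A f\<close>.\<close>

definition coinvariant_algebra ::
    "('n \<Rightarrow> 'n rpoly) \<Rightarrow> (real^'n^'n, 'n rpoly set) gmodule" where
  "coinvariant_algebra \<psi> =
     (let Q = poly_ring Quot (coinvariant_ideal \<psi>) in
      \<lparr>carrier = carrier Q, mult = mult Q, one = one Q, zero = zero Q, add = add Q,
       smult = (\<lambda>c C. coinvariant_class \<psi> (c *\<^sub>R 1) \<otimes>\<^bsub>Q\<^esub> C),
       act = (\<lambda>A C. poly_act A ` C)\<rparr>)"

definition orbit_module ::
    "(real^'n^'n) set \<Rightarrow> 'n rpoly \<Rightarrow> (real^'n^'n, 'n rpoly) gmodule" where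
  "orbit_module G f =
     poly_gmodule\<lparr>carrier := Real_Vector_Spaces.span ((\<lambda>A. poly_act A f) ` G)\<rparr>"

text \<open>In the last two conditions, \<open>inj_on\<close> expresses that the sum of the modules spanned by the
  orbits of the \<open>s j i\<close> is direct, and the image is that sum.\<close>

definition symmetry_adapted_basis ::
    "(real^'n^'n) set \<Rightarrow> ('n \<Rightarrow> 'n rpoly) \<Rightarrow>
     nat \<Rightarrow> (nat \<Rightarrow> (real^'n^'n, 'w) gmodule) \<Rightarrow> (nat \<Rightarrow> nat) \<Rightarrow>
     (nat \<Rightarrow> nat \<Rightarrow> 'n rpoly) \<Rightarrow> bool" where
  "symmetry_adapted_basis G \<psi> l \<theta> \<eta> s \<longleftrightarrow>
     (\<forall>(j, i) \<in> index_set l \<eta>.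
        homogeneous (s j i) \<and>
        irreducible_gmodule G (orbit_module G (s j i)) \<and>
        gmodule_isomorphic G (orbit_module G (s j i)) (\<theta> j) \<and>
        (\<exists>\<phi> \<in> gmodule_iso G (orbit_module G (s j 0)) (orbit_module G (s j i)).
           \<phi> (s j 0) = s j i)) \<and>
     (let I = index_set l \<eta>;
          X = (\<Pi>\<^sub>E (j, i)\<in>I. carrier (orbit_module G (s j i)));
          add_all = (\<lambda>x. \<Sum>p\<in>I. x p)
      in inj_on add_all X \<and>
         coinvariant_class \<psi> \<in>
           gmodule_iso G (poly_gmodule\<lparr>carrier := add_all ` X\<rparr>) (coinvariant_algebra \<psi>))"


section \<open>Matrix polynomials\<close>

definition mat_trace :: "'a::comm_monoid_add Matrix.mat \<Rightarrow> 'a" where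
  "mat_trace A = (\<Sum>i<dim_row A. A $$ (i, i))"

definition H_matrix ::
    "(real^'n^'n) set \<Rightarrow> (nat \<Rightarrow> nat) \<Rightarrow> (nat \<Rightarrow> nat \<Rightarrow> 'n rpoly) \<Rightarrow> nat \<Rightarrow> 'n rpoly Matrix.mat" where
  "H_matrix G \<eta> s j = Matrix.mat (\<eta> j) (\<eta> j) (\<lambda>(u, v). reynolds G (s j u * s j v))"

text \<open>Sums of squares among the \<open>k \<times> k\<close> matrices over the subring \<open>R\<close>.\<close>

definition sos_matrices :: "'n rpoly set \<Rightarrow> nat \<Rightarrow> 'n rpoly Matrix.mat set" where
  "sos_matrices R k = {A \<in> carrier_mat k k. elements_mat A \<subseteq> R \<and>
     (\<exists>m\<ge>1. \<exists>L \<in> carrier_mat m k. elements_mat L \<subseteq> R \<and> A = transpose_mat L * L)}"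

end

theory Submission
  imports Defs "HOL-Computational_Algebra.Polynomial"
begin

text \<open>\<open>Tr (H L\<^sup>t L)\<close> is a sum of terms \<open>R\<^sub>G ((\<Sum>u. L r u * s u)\<^sup>2)\<close>, one for each row
  \<open>r\<close> of \<open>L\<close>, hence an invariant sum of squares. Conversely, an invariant sum of squares is a sum of
  terms \<open>R\<^sub>G (q\<^sup>2)\<close>. By the graded Nakayama lemma \<open>q\<close> is a combination, with invariant coefficients, of
  the polynomials \<open>\<phi> j i e\<close>, where \<open>e\<close> runs through an orthonormal basis of the module spanned by the
  orbit of \<open>s j 0\<close> and \<open>\<phi> j i\<close> maps this module to its \<open>i\<close>-th copy. Each coefficient of
  \<open>R\<^sub>G (\<phi> j u x * \<phi> k v y)\<close> is an invariant bilinear form in \<open>x\<close> and \<open>y\<close>, so it vanishes for \<open>j \<noteq> k\<close>, and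
  for \<open>j = k\<close> it is proportional to the inner product once the endomorphisms of the module are known
  to be scalars. The factor is read off at \<open>x = y = s j 0\<close>, and \<open>R\<^sub>G (q\<^sup>2)\<close> becomes a sum of traces
  \<open>Tr (H c c\<^sup>t)\<close>.

  That real scalars are the only endomorphisms is where reflections enter: by Chevalley's argument
  the polynomials are free over the invariants on a lift of the coinvariant algebra, so a module of
  dimension \<open>d\<close> occurs there at most \<open>d / dim End\<close> times, and here it occurs \<open>d\<close> times.\<close>


section \<open>Evaluation of polynomials\<close>

text \<open>The matrix \<open>H\<close> records each averaged product at a single pair of vectors,
  so it determines the underlying invariant form only if the forms on a module make up a line. A
  non-scalar endomorphism \<open>J\<close> would give a further invariant form
  \<open>ip (J x) y\<close>; hence the effort spent on scalars. That the coinvariant algebra is a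
  regular representation enters as the hypothesis
  \<open>has_dimension (\<theta> j) (\<eta> j)\<close>. It is exploited by counting: the
  \<open>\<eta> j\<close> isomorphisms onto the copies and \<open>J\<close> are
  \<open>\<eta> j + 1\<close> vectors of polynomials with at most \<open>\<eta> j\<close>
  coordinates, so they are dependent over the polynomials. Averaging might kill every coefficient of
  the relation; multiplying first by one nonzero coefficient \<open>a p\<close> turns the average of
  that coefficient into a sum of squares, which is nonzero because a nonzero polynomial has a
  nonzero value at some real point. Real points also exclude zero divisors, which is what allows
  linear forms to be cancelled in Chevalley's argument.\<close>

abbreviation coef :: "('a \<Rightarrow>\<^sub>0 'b::zero) \<Rightarrow> 'a \<Rightarrow> 'b" where
  "coef \<equiv> Poly_Mapping.lookup"

lemma scaleR_eq_single_mult: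
  fixes f :: "'a::comm_monoid_add \<Rightarrow>\<^sub>0 'b::{real_algebra_1, comm_ring_1}"
  shows "c *\<^sub>R f = Poly_Mapping.single 0 (of_real c) * f"
proof -
  have "scaleR c = (*) (of_real c :: 'b)"
    by (rule ext) (simp add: scaleR_conv_of_real)
  then show ?thesis
    unfolding scaleR_poly_mapping_def by (simp add: mult_map_scale_conv_mult)
qed

text \<open>With this instance polynomials are themselves a possible target of \<open>peval\<close>,
  so substitutions can be composed.\<close>

instance poly_mapping :: (comm_monoid_add, "{real_algebra_1, comm_ring_1}") real_algebra_1
  by standard (simp_all add: scaleR_eq_single_mult mult.assoc mult.left_commute)

lemma sum_single_lookup:
  assumes "finite K" "Poly_Mapping.keys f \<subseteq> K"
  shows "f = (\<Sum>m\<in>K. Poly_Mapping.single m (coef f m))"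
proof (rule poly_mapping_eqI)
  fix k
  have "coef (\<Sum>m\<in>K. Poly_Mapping.single m (coef f m)) k
      = (\<Sum>m\<in>K. if m = k then coef f m else 0)"
    by (simp add: lookup_sum lookup_single when_def)
  also have "\<dots> = coef f k"
    using assms by (auto simp: in_keys_iff)
  finally show "coef f k = coef (\<Sum>m\<in>K. Poly_Mapping.single m (coef f m)) k" ..
qed

lemma single_eq_scaleR:
  "Poly_Mapping.single m (c::real) = c *\<^sub>R Poly_Mapping.single m 1"
  by (rule poly_mapping_eqI) (simp add: lookup_single when_def)

lemma sum_monomials:
  fixes f :: "'a \<Rightarrow>\<^sub>0 real"
  assumes "finite K" "Poly_Mapping.keys f \<subseteq> K"
  shows "f = (\<Sum>m\<in>K. coef f m *\<^sub>R Poly_Mapping.single m 1)"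
  using sum_single_lookup[OF assms] by (simp flip: single_eq_scaleR)

definition mon :: "('m::finite \<Rightarrow> 'a::comm_ring_1) \<Rightarrow> ('m \<Rightarrow>\<^sub>0 nat) \<Rightarrow> 'a" where
  "mon h m = (\<Prod>i\<in>UNIV. h i ^ coef m i)"

text \<open>The target is any commutative real algebra, so that substitution of polynomials and
  evaluation at a real point obey the same rules.\<close>

definition peval :: "('m::finite \<Rightarrow> 'a::{real_algebra_1, comm_ring_1}) \<Rightarrow> 'm rpoly \<Rightarrow> 'a" where
  "peval h f = (\<Sum>m\<in>Poly_Mapping.keys f. coef f m *\<^sub>R mon h m)"

lemma poly_subst_eq_peval: "poly_subst h = peval h"
  by (rule ext) (simp add: poly_subst_def peval_def mon_def)

lemma mon_add: "mon h (a + b) = mon h a * mon h b"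
  by (simp add: mon_def lookup_add power_add prod.distrib)

lemma mon_zero [simp]: "mon h 0 = 1"
  by (simp add: mon_def)

lemma mon_single [simp]: "mon h (Poly_Mapping.single i n) = h i ^ n"
proof -
  have "mon h (Poly_Mapping.single i n) = (\<Prod>k\<in>UNIV. if k = i then h i ^ n else 1)"
    unfolding mon_def by (rule prod.cong) (auto simp: lookup_single when_def)
  then show ?thesis by simp
qed

lemma peval_superset:
  assumes "finite K" "Poly_Mapping.keys f \<subseteq> K"
  shows "peval h f = (\<Sum>m\<in>K. coef f m *\<^sub>R mon h m)"
  unfolding peval_def using assms
  by (intro sum.mono_neutral_left) (auto simp: in_keys_iff)

lemma peval_add: "peval h (f + g) = peval h f + peval h g"
proof -
  let ?K = "Poly_Mapping.keys f \<union> Poly_Mapping.keys g"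
  have "Poly_Mapping.keys (f + g) \<subseteq> ?K" by (rule keys_add)
  then show ?thesis
    by (simp add: peval_superset[of ?K] lookup_add scaleR_add_left sum.distrib)
qed

lemma peval_scaleR: "peval h (c *\<^sub>R f) = c *\<^sub>R peval h f"
proof -
  have "Poly_Mapping.keys (c *\<^sub>R f) \<subseteq> Poly_Mapping.keys f"
    by (auto simp: in_keys_iff)
  then show ?thesis
    by (simp add: peval_superset[of "Poly_Mapping.keys f"] scaleR_sum_right)
qed

lemma linear_peval: "linear (peval h)"
  by (rule linearI) (simp_all add: peval_add peval_scaleR)

lemma peval_zero [simp]: "peval h 0 = 0"
  by (simp add: peval_def)

lemma peval_diff: "peval h (f - g) = peval h f - peval h g"
  by (rule linear_diff[OF linear_peval])

lemma peval_sum: "peval h (sum f K) = (\<Sum>k\<in>K. peval h (f k))"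
  by (rule linear_sum[OF linear_peval])

lemma peval_monomial [simp]: "peval h (Poly_Mapping.single m 1) = mon h m"
  by (simp add: peval_def)

lemma peval_one [simp]: "peval h 1 = 1"
  using peval_monomial[of h 0] by simp

lemma peval_Var [simp]: "peval h (Var i) = h i"
  by (simp add: Var_def)

lemma peval_mult: "peval h (f * g) = peval h f * peval h g"
proof -
  let ?M = "\<lambda>m. Poly_Mapping.single m (1::real)"
  have "f * g = (\<Sum>m\<in>Poly_Mapping.keys f. coef f m *\<^sub>R ?M m) *
      (\<Sum>m\<in>Poly_Mapping.keys g. coef g m *\<^sub>R ?M m)"
    using sum_monomials[of "Poly_Mapping.keys f" f] sum_monomials[of "Poly_Mapping.keys g" g]
    by simp
  also have "\<dots> = (\<Sum>m\<in>Poly_Mapping.keys f. \<Sum>m'\<in>Poly_Mapping.keys g.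
      (coef f m * coef g m') *\<^sub>R ?M (m + m'))"
    by (simp add: sum_product mult_single mult.commute)
  finally show ?thesis
    by (simp add: peval_sum peval_scaleR mon_add) (simp add: peval_def sum_product mult.commute)
qed

lemma peval_power: "peval h (f ^ n) = peval h f ^ n"
  by (induction n) (simp_all add: peval_mult)

lemma peval_prod: "peval h (prod f K) = (\<Prod>k\<in>K. peval h (f k))"
  by (induction K rule: infinite_finite_induct) (simp_all add: peval_mult)

lemma peval_mon: "peval k (mon h m) = mon (\<lambda>i. peval k (h i)) m"
  by (simp add: mon_def peval_prod peval_power)

lemma peval_peval: "peval k (peval h f) = peval (\<lambda>i. peval k (h i)) f"
proof -
  have "peval k (peval h f) = peval k (\<Sum>m\<in>Poly_Mapping.keys f. coef f m *\<^sub>R mon h m)"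
    by (simp add: peval_def[of h])
  then show ?thesis
    by (simp add: peval_sum peval_scaleR peval_mon) (simp add: peval_def)
qed

lemma mon_Var: "mon Var m = (Poly_Mapping.single m 1 :: 'm::finite rpoly)"
proof -
  have pow: "Poly_Mapping.single (Poly_Mapping.single i 1) 1 ^ k
      = (Poly_Mapping.single (Poly_Mapping.single i k) 1 :: 'm rpoly)" for i k
    by (induction k) (simp_all add: mult_single flip: single_add)
  have prod: "(\<Prod>i\<in>K. Poly_Mapping.single (f i) 1)
      = (Poly_Mapping.single (sum f K) 1 :: 'm rpoly)" for K :: "'m set" and f
    by (induction K rule: infinite_finite_induct) (simp_all add: mult_single)
  have "mon Var m = (Poly_Mapping.single (\<Sum>i\<in>UNIV. Poly_Mapping.single i (coef m i)) 1 :: 'm rpoly)"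
    unfolding mon_def Var_def pow prod ..
  also have "(\<Sum>i\<in>UNIV. Poly_Mapping.single i (coef m i)) = m"
    by (rule sum_single_lookup[symmetric]) simp_all
  finally show ?thesis .
qed

lemma peval_Var_eq [simp]: "peval Var f = f"
  unfolding peval_def mon_Var by (rule sum_monomials[symmetric]) simp_all

text \<open>Every \<open>f\<close> equals \<open>peval Var f\<close>, a combination of products of
  variables. Multiplying by a single variable at a time suits twisted product rules, where no step
  for two general factors is at hand.\<close>

lemma rpoly_induct [case_names add scale one var]:
  fixes f :: "'m::finite rpoly"
  assumes add: "\<And>f g. P f \<Longrightarrow> P g \<Longrightarrow> P (f + g)"
    and scale: "\<And>c f. P f \<Longrightarrow> P (c *\<^sub>R f)"
    and one: "P 1"
    and var: "\<And>i f. P f \<Longrightarrow> P (Var i * f)"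
  shows "P f"
proof -
  have pow: "P (Var i ^ k * f)" if "P f" for i k f
    using that by (induction k) (simp_all add: mult.assoc var)
  have prod: "P (\<Prod>i\<in>K. Var i ^ c i)" for K and c :: "'m \<Rightarrow> nat"
    by (induction K rule: infinite_finite_induct) (simp_all add: one pow)
  have zero: "P 0" using scale[OF one, of 0] by simp
  have "P (\<Sum>m\<in>K. coef f m *\<^sub>R mon Var m)" for K
    by (induction K rule: infinite_finite_induct)
      (auto simp: zero mon_def intro!: add scale prod)
  then have "P (peval Var f)" unfolding peval_def .
  then show ?thesis by simp
qed

section \<open>Real points at which polynomials do not vanish\<close>

lemma base_digits_inject:
  fixes a b :: "nat \<Rightarrow> nat"
  assumes "\<And>k. k < n \<Longrightarrow> a k < N" "\<And>k. k < n \<Longrightarrow> b k < N"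
    and "(\<Sum>k<n. N ^ k * a k) = (\<Sum>k<n. N ^ k * b k)" "i < n"
  shows "a i = b i"
  using assms
proof (induction n arbitrary: a b i)
  case (Suc n)
  have split: "(\<Sum>k<Suc n. N ^ k * c k) = c 0 + N * (\<Sum>k<n. N ^ k * c (Suc k))"
    for c :: "nat \<Rightarrow> nat"
    unfolding sum.lessThan_Suc_shift by (simp add: sum_distrib_left mult.assoc)
  have lt: "a 0 < N" "b 0 < N" using Suc.prems by simp_all
  have eq: "a 0 + N * (\<Sum>k<n. N ^ k * a (Suc k)) = b 0 + N * (\<Sum>k<n. N ^ k * b (Suc k))"
    using Suc.prems(3) unfolding split .
  from arg_cong[OF eq, of "\<lambda>x. x mod N"] lt have zero: "a 0 = b 0" by simp
  with eq lt have "(\<Sum>k<n. N ^ k * a (Suc k)) = (\<Sum>k<n. N ^ k * b (Suc k))" by simp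
  with Suc.IH[of "\<lambda>k. a (Suc k)" "\<lambda>k. b (Suc k)"] Suc.prems(1,2)
  have "\<And>i. i < n \<Longrightarrow> a (Suc i) = b (Suc i)" by simp
  with zero Suc.prems(4) show ?case by (cases i) simp_all
qed simp

text \<open>Kronecker substitution: with weights that are powers of a large base, distinct monomials
  restrict to distinct powers of the parameter of the curve \<open>t \<mapsto> (t ^ w i)\<close>.\<close>

lemma separating_weights:
  fixes U :: "('m::finite \<Rightarrow>\<^sub>0 nat) set"
  assumes "finite U"
  obtains w :: "'m \<Rightarrow> nat" where "inj_on (\<lambda>m. \<Sum>i\<in>UNIV. w i * coef m i) U"
proof -
  obtain idx where "bij_betw idx (UNIV :: 'm set) {0..<card (UNIV :: 'm set)}"
    using ex_bij_betw_finite_nat[of "UNIV :: 'm set"] by auto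
  then have idx: "bij_betw idx (UNIV :: 'm set) {..<card (UNIV :: 'm set)}"
    by (simp add: atLeast0LessThan)
  let ?n = "card (UNIV :: 'm set)"
  let ?g = "the_inv_into UNIV idx"
  have g: "bij_betw ?g {..<?n} UNIV" by (rule bij_betw_the_inv_into[OF idx])
  have idx_g: "idx (?g k) = k" if "k < ?n" for k
    using that idx by (simp add: bij_betw_def f_the_inv_into_f)
  have "finite ((\<lambda>(m, i). coef m i) ` (U \<times> UNIV))" using assms by simp
  \<comment> \<open>\<open>N\<close> exceeds all exponents occurring in \<open>U\<close>, so these
    are digits in base \<open>N\<close>; the variable \<open>i\<close> gets the weight
    \<open>N ^ idx i\<close>.\<close>
  then obtain N where "\<forall>x \<in> (\<lambda>(m, i). coef m i) ` (U \<times> UNIV). x < N"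
    using finite_nat_set_iff_bounded by blast
  then have N: "coef m i < N" if "m \<in> U" for m i using that by force
  have digits: "(\<Sum>i\<in>UNIV. N ^ idx i * coef m i) = (\<Sum>k<?n. N ^ k * coef m (?g k))" for m
    by (rule sum.reindex_bij_betw[OF g, symmetric, THEN trans]) (simp add: idx_g)
  have "inj_on (\<lambda>m. \<Sum>i\<in>UNIV. N ^ idx i * coef m i) U"
  proof (rule inj_onI)
    fix m m' assume mm: "m \<in> U" "m' \<in> U"
      and eq: "(\<Sum>i\<in>UNIV. N ^ idx i * coef m i) = (\<Sum>i\<in>UNIV. N ^ idx i * coef m' i)"
    have digit: "coef m (?g k) = coef m' (?g k)" if "k < ?n" for k
      using base_digits_inject[of ?n "\<lambda>k. coef m (?g k)" N "\<lambda>k. coef m' (?g k)" k]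
        N mm eq that unfolding digits by simp
    show "m = m'"
    proof (rule poly_mapping_eqI)
      fix i
      from g obtain k where "k < ?n" "i = ?g k"
        by (metis UNIV_I bij_betw_def imageE lessThan_iff)
      with digit show "coef m i = coef m' i" by simp
    qed
  qed
  then show thesis by (rule that)
qed

text \<open>Restricted to the curve \<open>t \<mapsto> (t ^ w i)\<close>, each member of
  \<open>F\<close> becomes a nonzero polynomial in \<open>t\<close>. Together these have finitely
  many roots, and any other \<open>t\<close> serves all of \<open>F\<close> at once.\<close>

lemma common_nonzero_point:
  fixes F :: "'m::finite rpoly set"
  assumes "finite F" "0 \<notin> F"
  obtains x :: "'m \<Rightarrow> real" where "\<And>f. f \<in> F \<Longrightarrow> peval x f \<noteq> 0"
proof -
  let ?U = "\<Union>f\<in>F. Poly_Mapping.keys f"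
  obtain w :: "'m \<Rightarrow> nat" where w: "inj_on (\<lambda>m. \<Sum>i\<in>UNIV. w i * coef m i) ?U"
    using separating_weights[of ?U] assms(1) by auto
  define e where "e m = (\<Sum>i\<in>UNIV. w i * coef m i)" for m :: "'m \<Rightarrow>\<^sub>0 nat"
  define P where "P f = (\<Sum>m\<in>Poly_Mapping.keys f. Polynomial.monom (coef f m) (e m))"
    for f :: "'m rpoly"
  have mon: "mon (\<lambda>i. t ^ w i) m = t ^ e m" for t :: real and m
    by (simp add: mon_def e_def power_sum power_mult)
  have P: "poly (P f) t = peval (\<lambda>i. t ^ w i) f" for f t
    by (simp add: P_def peval_def poly_sum poly_monom mon)
  have "P f \<noteq> 0" if f: "f \<in> F" for f
  proof -
    from f assms(2) have "f \<noteq> 0" by auto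
    then obtain m where m: "m \<in> Poly_Mapping.keys f"
      using keys_eq_empty by blast
    \<comment> \<open>The weights keep the monomials of \<open>F\<close> apart, so no other term
      contributes to the exponent \<open>e m\<close> and nothing cancels.\<close>
    have "Polynomial.coeff (P f) (e m) = (\<Sum>m'\<in>Poly_Mapping.keys f. if m' = m then coef f m' else 0)"
      unfolding P_def Polynomial.coeff_sum
    proof (rule sum.cong)
      fix m' assume m': "m' \<in> Poly_Mapping.keys f"
      with m f have "m \<in> ?U" "m' \<in> ?U" by auto
      with w have "e m = e m' \<longleftrightarrow> m = m'" unfolding e_def by (auto dest: inj_onD)
      then show "Polynomial.coeff (Polynomial.monom (coef f m') (e m')) (e m)
          = (if m' = m then coef f m' else 0)" by auto
    qed simp
    also have "\<dots> \<noteq> 0" using m by (simp add: in_keys_iff)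
    finally show ?thesis by auto
  qed
  then have "finite (\<Union>f\<in>F. {t. poly (P f) t = 0})"
    using assms(1) by (auto intro: poly_roots_finite)
  then obtain t where "t \<notin> (\<Union>f\<in>F. {t. poly (P f) t = 0})"
    using ex_new_if_finite infinite_UNIV_char_0 by blast
  then have "\<And>f. f \<in> F \<Longrightarrow> peval (\<lambda>i. t ^ w i) f \<noteq> 0" by (auto simp: P)
  then show thesis by (rule that)
qed

lemma rpoly_mult_eq_0_iff [simp]:
  fixes f g :: "'m::finite rpoly"
  shows "f * g = 0 \<longleftrightarrow> f = 0 \<or> g = 0"
proof
  assume fg: "f * g = 0"
  show "f = 0 \<or> g = 0"
  proof (rule ccontr)
    assume "\<not> (f = 0 \<or> g = 0)"
    then obtain x :: "'m \<Rightarrow> real" where "\<And>h. h \<in> {f, g} \<Longrightarrow> peval x h \<noteq> 0"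
      using common_nonzero_point[of "{f, g}"] by blast
    then have "peval x (f * g) \<noteq> 0" by (simp add: peval_mult)
    with fg show False by simp
  qed
qed auto

text \<open>At a real point the squares are nonnegative numbers with sum zero, so every
  \<open>f k\<close> vanishes at every real point.\<close>

lemma sum_squares_eq_0:
  fixes f :: "'k \<Rightarrow> 'm::finite rpoly"
  assumes "finite K" "(\<Sum>k\<in>K. (f k)\<^sup>2) = 0" "k \<in> K"
  shows "f k = 0"
proof (rule ccontr)
  assume "f k \<noteq> 0"
  then obtain x :: "'m \<Rightarrow> real" where x: "peval x (f k) \<noteq> 0"
    using common_nonzero_point[of "{f k}"] by auto
  have "(\<Sum>k\<in>K. (peval x (f k))\<^sup>2) = 0"
    using arg_cong[OF assms(2), of "peval x"] by (simp add: peval_sum peval_power)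
  then have "peval x (f k) = 0"
    using assms(1,3) by (simp add: sum_nonneg_eq_0_iff)
  with x show False by contradiction
qed

text \<open>More unknowns (\<open>I\<close>) than equations (\<open>K\<close>) force a nontrivial
  solution, also over the polynomials: Gaussian elimination works without division by
  cross-multiplying with the pivot.\<close>

lemma linear_relation:
  fixes u :: "'i \<Rightarrow> 'k \<Rightarrow> 'm::finite rpoly"
  assumes "finite K" "finite I" "card K < card I"
  shows "\<exists>a. (\<exists>i\<in>I. a i \<noteq> 0) \<and> (\<forall>k\<in>K. (\<Sum>i\<in>I. a i * u i k) = 0)"
  using assms
proof (induction K arbitrary: I u rule: finite_induct)
  case empty
  then have "I \<noteq> {}" by auto
  then show ?case by (intro exI[of _ "\<lambda>_. 1"]) auto
next
  case (insert k K)
  show ?case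
  proof (cases "\<forall>i\<in>I. u i k = 0")
    case True
    have "card K < card I" using insert by simp
    from insert.IH[OF insert.prems(1) this, of u] True show ?thesis by auto
  next
    case False
    then obtain p where p: "p \<in> I" "u p k \<noteq> 0" by blast
    \<comment> \<open>The pivot \<open>u p k\<close> eliminates the unknown \<open>p\<close> from
      the remaining equations.\<close>
    define v where "v i k' = u p k * u i k' - u i k * u p k'" for i k'
    have "card K < card (I - {p})" using insert p by simp
    from insert.IH[OF _ this, of v] insert.prems(1) obtain a
      where a: "\<exists>i\<in>I - {p}. a i \<noteq> 0" "\<forall>k'\<in>K. (\<Sum>i\<in>I - {p}. a i * v i k') = 0" by auto
    \<comment> \<open>Back substitution: the other unknowns are scaled by the pivot so that the
      equation for \<open>k\<close> can be solved for \<open>b p\<close> without dividing. They stay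
      nonzero because there are no zero divisors.\<close>
    define b where "b i = (if i = p then - (\<Sum>i\<in>I - {p}. a i * u i k) else a i * u p k)" for i
    have b_p: "b p = - (\<Sum>i\<in>I - {p}. a i * u i k)" by (simp add: b_def)
    have sum_b: "(\<Sum>i\<in>I. b i * u i k') = (\<Sum>i\<in>I - {p}. a i * v i k')" for k'
    proof -
      have "(\<Sum>i\<in>I. b i * u i k') = b p * u p k' + (\<Sum>i\<in>I - {p}. b i * u i k')"
        using insert.prems(1) p(1) by (rule sum.remove)
      also have "(\<Sum>i\<in>I - {p}. b i * u i k') = (\<Sum>i\<in>I - {p}. a i * u p k * u i k')"
        by (rule sum.cong) (auto simp: b_def)
      finally show ?thesis
        by (simp add: b_p v_def sum_distrib_left right_diff_distrib sum_subtractf ac_simps)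
    qed
    have "(\<Sum>i\<in>I - {p}. a i * v i k) = 0" by (simp add: v_def mult.commute)
    with a(2) have "\<forall>k'\<in>insert k K. (\<Sum>i\<in>I. b i * u i k') = 0" by (auto simp: sum_b)
    moreover have "\<exists>i\<in>I. b i \<noteq> 0" using a(1) p(2) by (auto simp: b_def)
    ultimately show ?thesis by blast
  qed
qed


section \<open>Homogeneous components and the group action\<close>

definition mdeg :: "('m::finite \<Rightarrow>\<^sub>0 nat) \<Rightarrow> nat" where
  "mdeg m = (\<Sum>i\<in>UNIV. coef m i)"

text \<open>Degrees are integers, so that a component of degree \<open>d - e\<close> vanishes when \<open>d < e\<close>.\<close>

definition homog :: "int \<Rightarrow> 'm::finite rpoly \<Rightarrow> bool" where
  "homog d f \<longleftrightarrow> (\<forall>m. coef f m \<noteq> 0 \<longrightarrow> int (mdeg m) = d)"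

definition hcomp :: "int \<Rightarrow> 'm::finite rpoly \<Rightarrow> 'm rpoly" where
  "hcomp d f = (\<Sum>m\<in>{m \<in> Poly_Mapping.keys f. int (mdeg m) = d}. Poly_Mapping.single m (coef f m))"

lemma mdeg_add: "mdeg (a + b) = mdeg a + mdeg b"
  by (simp add: mdeg_def lookup_add sum.distrib)

lemma mdeg_single [simp]: "mdeg (Poly_Mapping.single i n) = n"
  by (simp add: mdeg_def lookup_single when_def)

lemma mdeg_eq_0_iff [simp]: "mdeg m = 0 \<longleftrightarrow> m = 0"
  by (auto simp: mdeg_def intro: poly_mapping_eqI)

lemma homogD: "homog d f \<Longrightarrow> coef f m \<noteq> 0 \<Longrightarrow> int (mdeg m) = d"
  by (simp add: homog_def)

lemma homogeneous_iff_homog: "homogeneous f \<longleftrightarrow> (\<exists>d. homog (int d) f)"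
  unfolding homogeneous_def homog_def mdeg_def[symmetric] by (simp add: in_keys_iff Ball_def)

lemma homog_zero [simp]: "homog d 0"
  by (simp add: homog_def)

lemma homog_add: "homog d f \<Longrightarrow> homog d g \<Longrightarrow> homog d (f + g)"
  unfolding homog_def by (metis add_0 lookup_add)

lemma homog_diff: "homog d f \<Longrightarrow> homog d g \<Longrightarrow> homog d (f - g)"
  unfolding homog_def by (metis diff_zero lookup_minus)

lemma homog_scaleR: "homog d f \<Longrightarrow> homog d (c *\<^sub>R f)"
  by (auto simp: homog_def)

lemma homog_sum: "(\<And>k. k \<in> K \<Longrightarrow> homog d (f k)) \<Longrightarrow> homog d (sum f K)"
  by (induction K rule: infinite_finite_induct) (simp_all add: homog_add)

lemma homog_one [simp]: "homog 0 1"
  by (simp add: homog_def lookup_one when_def)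

lemma homog_Var [simp]: "homog 1 (Var i)"
  by (auto simp: homog_def Var_def lookup_single when_def)

lemma homog_mult:
  assumes "homog d f" "homog e g"
  shows "homog (d + e) (f * g)"
  unfolding homog_def
proof (intro allI impI)
  fix m assume "coef (f * g) m \<noteq> 0"
  then have "m \<in> Poly_Mapping.keys (f * g)" by (simp add: in_keys_iff)
  then obtain a b where "m = a + b" "coef f a \<noteq> 0" "coef g b \<noteq> 0"
    using keys_mult[of f g] by (auto simp: in_keys_iff)
  with assms show "int (mdeg m) = d + e" by (simp add: homog_def mdeg_add)
qed

lemma homog_power: "homog d f \<Longrightarrow> homog (int k * d) (f ^ k)"
  by (induction k) (auto simp: algebra_simps dest: homog_mult)

lemma homog_negative: "homog d f \<Longrightarrow> d < 0 \<Longrightarrow> f = 0"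
  by (rule poly_mapping_eqI) (force simp: homog_def)

lemma homog_0_const:
  assumes "homog 0 f"
  shows "f = coef f 0 *\<^sub>R 1"
proof (rule poly_mapping_eqI)
  fix m
  show "coef f m = coef (coef f 0 *\<^sub>R 1) m"
  proof (cases "m = 0")
    case False
    then have "coef f m = 0" using homogD[OF assms, of m] by auto
    with False show ?thesis by (simp add: lookup_one)
  qed simp
qed

lemma coef_0_homog: "homog d f \<Longrightarrow> d \<noteq> 0 \<Longrightarrow> coef f 0 = 0"
  using homogD[of d f 0] mdeg_eq_0_iff[of "0 :: 'a \<Rightarrow>\<^sub>0 nat"] by (auto simp del: mdeg_eq_0_iff)

lemma coef_hcomp: "coef (hcomp d f) m = (if int (mdeg m) = d then coef f m else 0)"
proof -
  have "coef (hcomp d f) m =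
      (\<Sum>k\<in>{k \<in> Poly_Mapping.keys f. int (mdeg k) = d}. if k = m then coef f k else 0)"
    by (simp add: hcomp_def lookup_sum lookup_single when_def)
  then show ?thesis by (auto simp: in_keys_iff)
qed

lemma homog_hcomp [simp]: "homog d (hcomp d f)"
  by (simp add: homog_def coef_hcomp)

lemma hcomp_homog: "homog e f \<Longrightarrow> hcomp d f = (if d = e then f else 0)"
  by (rule poly_mapping_eqI) (auto simp: homog_def coef_hcomp)

lemma linear_hcomp: "linear (hcomp d)"
  by (rule linearI; rule poly_mapping_eqI) (simp_all add: coef_hcomp lookup_add)

lemma hcomp_zero [simp]: "hcomp d 0 = 0"
  by (rule linear_0[OF linear_hcomp])

lemma hcomp_add: "hcomp d (f + g) = hcomp d f + hcomp d g"
  by (rule linear_add[OF linear_hcomp])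

lemma hcomp_sum: "hcomp d (sum f K) = (\<Sum>k\<in>K. hcomp d (f k))"
  by (rule linear_sum[OF linear_hcomp])

lemma sum_hcomp:
  assumes "finite D" "\<And>m. coef f m \<noteq> 0 \<Longrightarrow> int (mdeg m) \<in> D"
  shows "f = (\<Sum>d\<in>D. hcomp d f)"
  by (rule poly_mapping_eqI) (use assms in \<open>auto simp: lookup_sum coef_hcomp\<close>)

text \<open>The additional degree \<open>x\<close> ensures that a component of interest is among the
  summands even when it is zero.\<close>

lemma finite_degrees:
  obtains D where "finite D" "x \<in> D" "\<And>m. coef f m \<noteq> 0 \<Longrightarrow> int (mdeg m) \<in> D"
  by (rule that[of "insert x ((\<lambda>m. int (mdeg m)) ` Poly_Mapping.keys f)"]) (auto simp: in_keys_iff)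

text \<open>A homogeneous factor shifts all degrees by \<open>e\<close>. This holds also for
  \<open>d < e\<close>, where both sides vanish.\<close>

lemma hcomp_mult:
  assumes g: "homog e g"
  shows "hcomp d (f * g) = hcomp (d - e) f * g"
proof -
  obtain D where D: "finite D" "d - e \<in> D" "\<And>m. coef f m \<noteq> 0 \<Longrightarrow> int (mdeg m) \<in> D"
    using finite_degrees by blast
  have f: "f = (\<Sum>k\<in>D. hcomp k f)" using D by (intro sum_hcomp)
  have "hcomp d (f * g) = (\<Sum>k\<in>D. hcomp d (hcomp k f * g))"
    by (subst f) (simp add: sum_distrib_right hcomp_sum)
  also have "\<dots> = (\<Sum>k\<in>D. if k = d - e then hcomp k f * g else 0)"
    by (rule sum.cong) (auto simp: hcomp_homog[OF homog_mult[OF homog_hcomp g]])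
  finally show ?thesis using D by simp
qed

lemma homog_mon:
  assumes "\<And>i. homog 1 (h i)"
  shows "homog (int (mdeg m)) (mon h m)"
proof -
  have "homog (\<Sum>i\<in>K. int (c i)) (\<Prod>i\<in>K. h i ^ c i)" for c and K
    by (induction K rule: infinite_finite_induct)
      (use homog_power[OF assms] in \<open>auto intro: homog_mult\<close>)
  from this[where K = UNIV and c = "coef m"] show ?thesis by (simp add: mon_def mdeg_def)
qed

lemma homog_peval:
  assumes "\<And>i. homog 1 (h i)" "homog d f"
  shows "homog d (peval h f)"
  unfolding peval_def
proof (intro homog_sum homog_scaleR)
  fix m assume "m \<in> Poly_Mapping.keys f"
  with assms(2) have "d = int (mdeg m)" by (simp add: homog_def in_keys_iff)
  with homog_mon[of h m] assms(1) show "homog d (mon h m)" by simp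
qed

lemma hcomp_peval:
  assumes "\<And>i. homog 1 (h i)"
  shows "hcomp d (peval h f) = peval h (hcomp d f)"
proof -
  obtain D where D: "finite D" "d \<in> D" "\<And>m. coef f m \<noteq> 0 \<Longrightarrow> int (mdeg m) \<in> D"
    using finite_degrees by blast
  have f: "f = (\<Sum>k\<in>D. hcomp k f)" using D by (intro sum_hcomp)
  have "hcomp d (peval h f) = (\<Sum>k\<in>D. hcomp d (peval h (hcomp k f)))"
    by (subst f) (simp add: peval_sum hcomp_sum)
  also have "\<dots> = (\<Sum>k\<in>D. if d = k then peval h (hcomp k f) else 0)"
    by (rule sum.cong) (simp_all add: hcomp_homog[OF homog_peval[OF assms homog_hcomp]])
  finally show ?thesis using D by simp
qed

section \<open>Matrices acting by linear substitution\<close>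

definition act_form :: "real^'n^'n \<Rightarrow> 'n \<Rightarrow> 'n rpoly" where
  "act_form A i = (\<Sum>j\<in>UNIV. (matrix_inv A $ i $ j) *\<^sub>R Var j)"

lemma poly_act_eq_peval: "poly_act A = peval (act_form A)"
  by (simp add: poly_act_def poly_subst_eq_peval act_form_def[abs_def])

lemma homog_act_form: "homog 1 (act_form A i)"
  by (simp add: act_form_def homog_sum homog_scaleR)

lemma linear_poly_act: "linear (poly_act A)"
  by (simp add: poly_act_eq_peval linear_peval)

lemma poly_act_mult: "poly_act A (f * g) = poly_act A f * poly_act A g"
  by (simp add: poly_act_eq_peval peval_mult)

lemma poly_act_one [simp]: "poly_act A 1 = 1"
  by (simp add: poly_act_eq_peval)

lemma poly_act_Var: "poly_act A (Var i) = act_form A i"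
  by (simp add: poly_act_eq_peval)

lemmas poly_act_zero [simp] = linear_0[OF linear_poly_act]
  and poly_act_add = linear_add[OF linear_poly_act]
  and poly_act_diff = linear_diff[OF linear_poly_act]
  and poly_act_scaleR = linear_scale[OF linear_poly_act]
  and poly_act_sum = linear_sum[OF linear_poly_act]

lemma poly_act_power: "poly_act A (f ^ k) = poly_act A f ^ k"
  by (simp add: poly_act_eq_peval peval_power)

lemma homog_poly_act: "homog d f \<Longrightarrow> homog d (poly_act A f)"
  unfolding poly_act_eq_peval by (intro homog_peval homog_act_form)

lemma hcomp_poly_act: "hcomp d (poly_act A f) = poly_act A (hcomp d f)"
  unfolding poly_act_eq_peval by (intro hcomp_peval homog_act_form)

lemma matrix_inv_inverse:
  fixes A :: "real^'n^'n"
  assumes "invertible A"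
  shows matrix_inv_right: "A ** matrix_inv A = Finite_Cartesian_Product.mat 1"
    and matrix_inv_left: "matrix_inv A ** A = Finite_Cartesian_Product.mat 1"
  using someI_ex[OF assms[unfolded invertible_def]] by (simp_all add: matrix_inv_def)

lemma matrix_inv_eqI:
  fixes A B :: "real^'n^'n"
  assumes "A ** B = Finite_Cartesian_Product.mat 1"
  shows "matrix_inv A = B"
proof -
  have "invertible A" using assms by (auto simp: invertible_right_inverse)
  then have "matrix_inv A ** A = Finite_Cartesian_Product.mat 1"
    by (rule matrix_inv_left)
  then have "matrix_inv A ** (A ** B) = B" by (simp add: matrix_mul_assoc)
  then show ?thesis by (simp add: assms)
qed

lemma matrix_inv_mult_distrib:
  fixes A B :: "real^'n^'n"
  assumes "invertible A" "invertible B"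
  shows "matrix_inv (A ** B) = matrix_inv B ** matrix_inv A"
proof (rule matrix_inv_eqI)
  have "A ** B ** (matrix_inv B ** matrix_inv A) = A ** (B ** matrix_inv B) ** matrix_inv A"
    by (simp add: matrix_mul_assoc)
  then show "A ** B ** (matrix_inv B ** matrix_inv A) = Finite_Cartesian_Product.mat 1"
    using assms by (simp add: matrix_inv_right)
qed

lemma poly_act_mat_1 [simp]: "poly_act (Finite_Cartesian_Product.mat 1) f = f"
proof -
  have "matrix_inv (Finite_Cartesian_Product.mat 1 :: real^'a^'a) = Finite_Cartesian_Product.mat 1"
    by (rule matrix_inv_eqI) simp
  then have "act_form (Finite_Cartesian_Product.mat 1 :: real^'a^'a) = Var"
    by (auto simp: act_form_def Finite_Cartesian_Product.mat_def if_distrib[of "\<lambda>c. c *\<^sub>R _"] cong: if_cong)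
  then show ?thesis by (simp add: poly_act_eq_peval)
qed

text \<open>Inversion reverses the order of the product and substitution reverses it once more, so
  the action is from the left.\<close>

lemma poly_act_comp:
  assumes "invertible A" "invertible B"
  shows "poly_act (A ** B) f = poly_act A (poly_act B f)"
proof -
  have "act_form (A ** B) i = peval (act_form A) (act_form B i)" for i
  proof -
    have "act_form (A ** B) i
        = (\<Sum>j\<in>UNIV. \<Sum>k\<in>UNIV. (matrix_inv B $ i $ k * matrix_inv A $ k $ j) *\<^sub>R Var j)"
      by (simp add: act_form_def matrix_inv_mult_distrib[OF assms])
        (simp add: matrix_matrix_mult_def scaleR_sum_left)
    also have "\<dots> = (\<Sum>k\<in>UNIV. matrix_inv B $ i $ k *\<^sub>R act_form A k)"
      by (subst sum.swap) (simp add: act_form_def scaleR_sum_right)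
    finally show ?thesis by (simp add: act_form_def[of B] peval_sum peval_scaleR)
  qed
  then have "act_form (A ** B) = (\<lambda>i. peval (act_form A) (act_form B i))" by (rule ext)
  then show ?thesis by (simp add: poly_act_eq_peval peval_peval)
qed

section \<open>Invariants and the Reynolds operator\<close>

lemma invariantsD: "f \<in> invariants G \<Longrightarrow> A \<in> G \<Longrightarrow> poly_act A f = f"
  by (simp add: invariants_def)

lemma invariants_one [simp]: "1 \<in> invariants G"
  by (simp add: invariants_def)

lemma invariants_zero [simp]: "0 \<in> invariants G"
  by (simp add: invariants_def)

lemma invariants_add: "f \<in> invariants G \<Longrightarrow> g \<in> invariants G \<Longrightarrow> f + g \<in> invariants G"
  by (simp add: invariants_def poly_act_add)

lemma invariants_mult: "f \<in> invariants G \<Longrightarrow> g \<in> invariants G \<Longrightarrow> f * g \<in> invariants G"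
  by (simp add: invariants_def poly_act_mult)

lemma invariants_scaleR: "f \<in> invariants G \<Longrightarrow> c *\<^sub>R f \<in> invariants G"
  by (simp add: invariants_def poly_act_scaleR)

lemma invariants_sum: "(\<And>k. k \<in> K \<Longrightarrow> f k \<in> invariants G) \<Longrightarrow> sum f K \<in> invariants G"
  by (induction K rule: infinite_finite_induct) (simp_all add: invariants_add)

lemma invariants_hcomp: "f \<in> invariants G \<Longrightarrow> hcomp d f \<in> invariants G"
  by (simp add: invariants_def flip: hcomp_poly_act)

locale finite_matrix_group =
  fixes G :: "(real^'n^'n) set"
  assumes finite_G: "finite G"
    and one_closed: "Finite_Cartesian_Product.mat 1 \<in> G"
    and mult_closed: "A \<in> G \<Longrightarrow> B \<in> G \<Longrightarrow> A ** B \<in> G"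
    and G_invertible: "A \<in> G \<Longrightarrow> invertible A"
    and inv_closed: "A \<in> G \<Longrightarrow> matrix_inv A \<in> G"
begin

lemma card_G: "card G > 0"
  using finite_G one_closed by (auto simp: card_gt_0_iff)

lemma act_comp: "A \<in> G \<Longrightarrow> B \<in> G \<Longrightarrow> poly_act (A ** B) f = poly_act A (poly_act B f)"
  by (simp add: poly_act_comp G_invertible)

lemma mult_inv: "A \<in> G \<Longrightarrow> A ** matrix_inv A = Finite_Cartesian_Product.mat 1"
  "A \<in> G \<Longrightarrow> matrix_inv A ** A = Finite_Cartesian_Product.mat 1"
  using G_invertible by (simp_all add: matrix_inv_right matrix_inv_left)

lemma act_inv:
  assumes "A \<in> G"
  shows "poly_act A (poly_act (matrix_inv A) f) = f"
    and "poly_act (matrix_inv A) (poly_act A f) = f"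
  using assms by (simp_all add: inv_closed mult_inv flip: act_comp)

lemma sum_mult_left:
  assumes "B \<in> G"
  shows "(\<Sum>A\<in>G. F (B ** A)) = (\<Sum>A\<in>G. F A)"
  by (rule sum.reindex_bij_witness[of _ "\<lambda>A. matrix_inv B ** A" "\<lambda>A. B ** A"])
    (use assms in \<open>simp_all add: mult_closed inv_closed mult_inv matrix_mul_assoc\<close>)

lemma sum_mult_right:
  assumes "B \<in> G"
  shows "(\<Sum>A\<in>G. F (A ** B)) = (\<Sum>A\<in>G. F A)"
  by (rule sum.reindex_bij_witness[of _ "\<lambda>A. A ** matrix_inv B" "\<lambda>A. A ** B"])
    (use assms in \<open>simp_all add: mult_closed inv_closed mult_inv flip: matrix_mul_assoc\<close>)

lemma reynolds_invariant: "reynolds G f \<in> invariants G"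
  unfolding invariants_def
proof (intro CollectI ballI)
  fix B assume B: "B \<in> G"
  have "poly_act B (\<Sum>A\<in>G. poly_act A f) = (\<Sum>A\<in>G. poly_act (B ** A) f)"
    using B by (simp add: poly_act_sum act_comp)
  also have "\<dots> = (\<Sum>A\<in>G. poly_act A f)" using B by (rule sum_mult_left)
  finally show "poly_act B (reynolds G f) = reynolds G f"
    by (simp add: reynolds_def poly_act_scaleR)
qed

lemma reynolds_act: "B \<in> G \<Longrightarrow> reynolds G (poly_act B f) = reynolds G f"
  using sum_mult_right[of B "\<lambda>A. poly_act A f"] by (simp add: reynolds_def act_comp)

lemma reynolds_of_invariant: "f \<in> invariants G \<Longrightarrow> reynolds G f = f"
  using card_G by (simp add: reynolds_def invariantsD sum_constant_scaleR del: sum_constant)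

lemma linear_reynolds: "linear (reynolds G)"
  unfolding reynolds_def
  by (rule linearI)
    (simp_all add: poly_act_add poly_act_scaleR sum.distrib scaleR_add_right scaleR_sum_right ac_simps)

lemmas reynolds_add = linear_add[OF linear_reynolds]
  and reynolds_scaleR = linear_scale[OF linear_reynolds]
  and reynolds_sum = linear_sum[OF linear_reynolds]

lemma reynolds_mult: "g \<in> invariants G \<Longrightarrow> reynolds G (g * f) = g * reynolds G f"
  by (simp add: reynolds_def poly_act_mult invariantsD sum_distrib_left)

lemma homog_reynolds: "homog d f \<Longrightarrow> homog d (reynolds G f)"
  by (simp add: reynolds_def homog_scaleR homog_sum homog_poly_act)

end


section \<open>Reflections and freeness over the invariants\<close>

lemma inv_GL:
  fixes A :: "real^'n^'n"
  assumes "invertible A"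
  shows "inv\<^bsub>GL\<^esub> A = matrix_inv A"
  unfolding m_inv_def
proof (rule the_equality)
  have "invertible (matrix_inv A)"
    using matrix_inv_left[OF assms] matrix_inv_right[OF assms] invertible_def by blast
  with assms show "matrix_inv A \<in> carrier GL \<and> A \<otimes>\<^bsub>GL\<^esub> matrix_inv A = \<one>\<^bsub>GL\<^esub>
      \<and> matrix_inv A \<otimes>\<^bsub>GL\<^esub> A = \<one>\<^bsub>GL\<^esub>"
    by (simp add: GL_def matrix_inv_left matrix_inv_right)
qed (auto simp: GL_def matrix_inv_eqI)

lemma finite_matrix_group_GL:
  assumes "finite G" "subgroup G GL"
  shows "finite_matrix_group G"
proof
  interpret subgroup G GL by fact
  show "finite G" by fact
  show "Finite_Cartesian_Product.mat 1 \<in> G"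
    using one_closed by (simp add: GL_def)
  show "A ** B \<in> G" if "A \<in> G" "B \<in> G" for A B
    using m_closed[OF that] by (simp add: GL_def)
  show inv: "invertible A" if "A \<in> G" for A
    using that subset by (auto simp: GL_def)
  show "matrix_inv A \<in> G" if "A \<in> G" for A
    using m_inv_closed[OF that] inv_GL[OF inv[OF that]] by simp
qed

text \<open>The identity minus \<open>A\<close> vanishes on the fixed hyperplane, hence has rank at
  most one. The vector \<open>w\<close> is normal to the hyperplane, while \<open>v\<close> spans
  the direction that is moved; they need not be parallel, as \<open>A\<close> need not be
  orthogonal.\<close>

lemma reflection_rank_one:
  fixes A :: "real^'n^'n"
  assumes "reflection A"
  obtains w v where "w \<noteq> 0" "\<And>x. x - A *v x = (w \<bullet> x) *\<^sub>R v"
proof -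
  let ?K = "{x. A *v x = x}"
  have K: "subspace ?K"
    by (rule subspaceI) (simp_all add: matrix_vector_right_distrib matrix_vector_mult_scaleR)
  from assms have "dim ?K = DIM(real^'n) - 1" by (simp add: reflection_def)
  then obtain w where w: "w \<noteq> 0" "span ?K = {x. w \<bullet> x = 0}"
    using dim_eq_hyperplane[of ?K] by auto
  then have fix_iff: "A *v x = x \<longleftrightarrow> w \<bullet> x = 0" for x
    using K by (auto simp flip: span_eq_iff)
  \<comment> \<open>Forced by the claim at \<open>x = w\<close>.\<close>
  define v where "v = (1 / (w \<bullet> w)) *\<^sub>R (w - A *v w)"
  have "x - A *v x = (w \<bullet> x) *\<^sub>R v" for x
  proof -
    \<comment> \<open>The orthogonal projection of \<open>x\<close> to the hyperplane, which
      \<open>A\<close> fixes.\<close>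
    define y where "y = x - ((w \<bullet> x) / (w \<bullet> w)) *\<^sub>R w"
    have "A *v y = y" using w(1) by (simp add: fix_iff y_def inner_diff_right)
    then have "A *v x - ((w \<bullet> x) / (w \<bullet> w)) *\<^sub>R (A *v w) = x - ((w \<bullet> x) / (w \<bullet> w)) *\<^sub>R w"
      by (simp add: y_def matrix_vector_mult_diff_distrib matrix_vector_mult_scaleR)
    then show ?thesis by (simp add: v_def algebra_simps)
  qed
  with w(1) show thesis by (rule that)
qed

lemma coef_Var: "coef (Var i) (Poly_Mapping.single j (Suc 0)) = (if i = j then 1 else 0)"
proof -
  have "Poly_Mapping.single i (1::nat) = Poly_Mapping.single j 1 \<longleftrightarrow> i = j"
    by (metis lookup_single_eq lookup_single_not_eq zero_neq_one)
  then show ?thesis by (simp add: Var_def lookup_single when_def)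
qed

lemma reflection_matrix_inv: "reflection A \<Longrightarrow> matrix_inv A = A"
  by (simp add: reflection_def matrix_inv_eqI)

text \<open>\<open>f - poly_act A f\<close> vanishes on the fixed hyperplane, whose equation is
  \<open>l\<close>. That \<open>l\<close> is the same for all \<open>f\<close> is essential: it
  becomes a common factor of a whole relation.\<close>

lemma reflection_divided_difference:
  fixes A :: "real^'n^'n"
  assumes A: "reflection A"
  obtains l where "l \<noteq> 0" "homog 1 l" "\<And>f. \<exists>k. f - poly_act A f = l * k"
proof -
  obtain w v where w: "w \<noteq> 0" and wv: "\<And>x. x - A *v x = (w \<bullet> x) *\<^sub>R v"
    using reflection_rank_one[OF A] by blast
  define l where "l = (\<Sum>j\<in>UNIV. w $ j *\<^sub>R Var j)"
  from w obtain j where "w $ j \<noteq> 0" by (auto simp: Finite_Cartesian_Product.vec_eq_iff)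
  moreover have "coef l (Poly_Mapping.single j 1) = w $ j"
    by (simp add: l_def lookup_sum coef_Var if_distrib[of "\<lambda>x. _ * x"] cong: if_cong)
  ultimately have l0: "l \<noteq> 0" by auto
  have lh: "homog 1 l" by (simp add: l_def homog_sum homog_scaleR)
  have entry: "(if i = j then 1 else 0) - A $ i $ j = v $ i * w $ j" for i j
  proof -
    have "(axis j 1 - A *v axis j 1) $ i = (w \<bullet> axis j 1) * v $ i" by (simp add: wv)
    moreover have "axis j 1 $ i = (if i = j then 1 else 0 :: real)" by (simp add: axis_def)
    ultimately show ?thesis
      by (simp add: inner_axis matrix_vector_mul_component mult.commute)
  qed
  have var: "Var i - poly_act A (Var i) = l * (v $ i *\<^sub>R 1)" for i
  proof -
    have "Var i = (\<Sum>j\<in>UNIV. (if i = j then 1 else 0::real) *\<^sub>R Var j)"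
      by (simp add: if_distrib[of "\<lambda>c. c *\<^sub>R _"] cong: if_cong)
    then have "Var i - poly_act A (Var i)
        = (\<Sum>j\<in>UNIV. ((if i = j then 1 else 0) - A $ i $ j) *\<^sub>R Var j)"
      unfolding poly_act_Var act_form_def reflection_matrix_inv[OF A]
      by (simp only: scaleR_diff_left sum_subtractf)
    then show ?thesis unfolding entry by (simp add: l_def scaleR_sum_right)
  qed
  have "\<exists>k. f - poly_act A f = l * k" for f
  proof (induction f rule: rpoly_induct)
    case (add f g)
    then obtain k k' where "f - poly_act A f = l * k" "g - poly_act A g = l * k'" by blast
    moreover have "(f + g) - poly_act A (f + g) = (f - poly_act A f) + (g - poly_act A g)"
      by (simp add: poly_act_add)
    ultimately have "(f + g) - poly_act A (f + g) = l * (k + k')" by (simp only: distrib_left)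
    then show ?case ..
  next
    case (scale c f)
    then obtain k where "f - poly_act A f = l * k" by blast
    then have "c *\<^sub>R f - poly_act A (c *\<^sub>R f) = l * (c *\<^sub>R k)"
      by (simp add: poly_act_scaleR flip: scaleR_diff_right)
    then show ?case ..
  next
    case one
    show ?case by (rule exI[of _ 0]) simp
  next
    case (var i f)
    then obtain k where k: "f - poly_act A f = l * k" by blast
    \<comment> \<open>A twisted Leibniz rule reduces divisibility to the variables, where it is the
      rank-one formula.\<close>
    have "Var i * f - poly_act A (Var i * f)
        = (Var i - poly_act A (Var i)) * f + poly_act A (Var i) * (f - poly_act A f)"
      by (simp add: poly_act_mult algebra_simps)
    also have "\<dots> = l * (v $ i *\<^sub>R 1 * f + poly_act A (Var i) * k)"
      unfolding k \<open>\<And>i. Var i - poly_act A (Var i) = l * (v $ i *\<^sub>R 1)\<close>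
      by (simp add: algebra_simps)
    finally show ?case ..
  qed
  with l0 lh show thesis by (rule that)
qed

section \<open>The ideal generated by the fundamental invariants\<close>

definition psi_ideal :: "('m::finite \<Rightarrow> 'n rpoly) \<Rightarrow> 'n rpoly set" where
  "psi_ideal \<psi> = range (\<lambda>a. \<Sum>i\<in>UNIV. a i * \<psi> i)"

lemma psi_idealI: "(\<Sum>i\<in>UNIV. a i * \<psi> i) \<in> psi_ideal \<psi>"
  by (auto simp: psi_ideal_def)

lemma psi_idealE:
  assumes "f \<in> psi_ideal \<psi>"
  obtains a where "f = (\<Sum>i\<in>UNIV. a i * \<psi> i)"
  using assms by (auto simp: psi_ideal_def)

lemma psi_ideal_zero [simp]: "0 \<in> psi_ideal \<psi>"
  using psi_idealI[of "\<lambda>_. 0" \<psi>] by simp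

lemma psi_ideal_add:
  assumes "f \<in> psi_ideal \<psi>" "g \<in> psi_ideal \<psi>"
  shows "f + g \<in> psi_ideal \<psi>"
proof -
  obtain a b where "f = (\<Sum>i\<in>UNIV. a i * \<psi> i)" "g = (\<Sum>i\<in>UNIV. b i * \<psi> i)"
    using assms by (auto elim!: psi_idealE)
  then have "f + g = (\<Sum>i\<in>UNIV. (a i + b i) * \<psi> i)" by (simp add: algebra_simps sum.distrib)
  then show ?thesis by (simp only: psi_idealI)
qed

lemma psi_ideal_mult:
  assumes "f \<in> psi_ideal \<psi>"
  shows "g * f \<in> psi_ideal \<psi>"
proof -
  obtain a where "f = (\<Sum>i\<in>UNIV. a i * \<psi> i)" using assms by (rule psi_idealE)
  then have "g * f = (\<Sum>i\<in>UNIV. (g * a i) * \<psi> i)" by (simp add: sum_distrib_left mult.assoc)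
  then show ?thesis by (simp only: psi_idealI)
qed

lemma psi_ideal_scaleR:
  fixes \<psi> :: "'m::finite \<Rightarrow> 'n rpoly"
  shows "f \<in> psi_ideal \<psi> \<Longrightarrow> c *\<^sub>R f \<in> psi_ideal \<psi>"
  using psi_ideal_mult[of f \<psi> "c *\<^sub>R 1"] by simp

lemma psi_ideal_minus:
  fixes \<psi> :: "'m::finite \<Rightarrow> 'n rpoly"
  shows "f \<in> psi_ideal \<psi> \<Longrightarrow> - f \<in> psi_ideal \<psi>"
  using psi_ideal_mult[of f \<psi> "- 1"] by simp

lemma psi_ideal_diff: "f \<in> psi_ideal \<psi> \<Longrightarrow> g \<in> psi_ideal \<psi> \<Longrightarrow> f - g \<in> psi_ideal \<psi>"
  using psi_ideal_add[of f \<psi> "- g"] psi_ideal_minus[of g \<psi>] by simp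

lemma psi_ideal_sum:
  "(\<And>k. k \<in> K \<Longrightarrow> f k \<in> psi_ideal \<psi>) \<Longrightarrow> sum f K \<in> psi_ideal \<psi>"
  by (induction K rule: infinite_finite_induct) (simp_all add: psi_ideal_add)

lemma psi_ideal_generator: "\<psi> i \<in> psi_ideal \<psi>"
  using psi_idealI[of "\<lambda>k. if k = i then 1 else 0" \<psi>]
  by (simp add: if_distrib[of "\<lambda>x. x * _"] cong: if_cong)

locale reflection_invariants = finite_matrix_group G
  for G :: "(real^'n^'n) set" +
  fixes \<psi> :: "'n \<Rightarrow> 'n rpoly"
  assumes generate_G: "generate GL {A \<in> G. reflection A} = G"
    and fund: "fundamental_invariants G \<psi>"
begin

lemma generated_algebra_eq: "generated_algebra \<psi> = invariants G"
  using fund by (simp add: fundamental_invariants_def)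

lemma invariant_eq_peval:
  assumes "f \<in> invariants G"
  obtains p where "f = peval \<psi> p"
  using assms unfolding generated_algebra_eq[symmetric] generated_algebra_def poly_subst_eq_peval
  by blast

lemma psi_invariant: "\<psi> i \<in> invariants G"
  unfolding generated_algebra_eq[symmetric] generated_algebra_def poly_subst_eq_peval
  by (rule image_eqI[of _ _ "Var i"]) simp_all

text \<open>Homogeneous of degree 0 means constant, and a constant \<open>\<psi> i = c\<close> would
  satisfy the algebraic relation \<open>Var i - c\<close>.\<close>

lemma psi_homog:
  obtains e :: "'n \<Rightarrow> int" where "\<And>i. homog (e i) (\<psi> i)" "\<And>i. e i > 0"
proof -
  have "\<exists>d. homog d (\<psi> i) \<and> d > 0" for i
  proof -
    obtain d where d: "homog (int d) (\<psi> i)"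
      using fund by (auto simp: fundamental_invariants_def homogeneous_iff_homog)
    have "d \<noteq> 0"
    proof
      assume "d = 0"
      with d obtain c where "\<psi> i = c *\<^sub>R 1" using homog_0_const by auto
      then have "peval \<psi> (Var i - c *\<^sub>R 1) = 0"
        by (simp add: peval_diff peval_scaleR)
      then have "Var i - c *\<^sub>R 1 = 0"
        using fund unfolding fundamental_invariants_def algebraically_independent_def
          poly_subst_eq_peval by blast
      then have "homog 0 (Var i :: 'n rpoly)" by (simp add: homog_scaleR)
      then show False
        using homogD[of 0 "Var i" "Poly_Mapping.single i 1"] by (simp add: coef_Var)
    qed
    with d show ?thesis by (intro exI[of _ "int d"]) simp
  qed
  then show thesis using that by metis
qed

lemma psi_ideal_act:
  assumes "A \<in> G" "f \<in> psi_ideal \<psi>"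
  shows "poly_act A f \<in> psi_ideal \<psi>"
proof -
  obtain a where "f = (\<Sum>i\<in>UNIV. a i * \<psi> i)" using assms(2) by (rule psi_idealE)
  then have "poly_act A f = (\<Sum>i\<in>UNIV. poly_act A (a i) * \<psi> i)"
    using assms(1) by (simp add: poly_act_sum poly_act_mult invariantsD[OF psi_invariant])
  then show ?thesis by (simp only: psi_idealI)
qed

text \<open>The generators have positive degree, so in degree 0 their coefficients would need
  negative degree.\<close>

lemma coef_0_psi_ideal:
  assumes "f \<in> psi_ideal \<psi>"
  shows "coef f 0 = 0"
proof -
  obtain e where e: "\<And>i. homog (e i) (\<psi> i)" "\<And>i. e i > 0" by (rule psi_homog) blast
  obtain a where "f = (\<Sum>i\<in>UNIV. a i * \<psi> i)" using assms by (rule psi_idealE)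
  then have "hcomp 0 f = (\<Sum>i\<in>UNIV. hcomp (0 - e i) (a i) * \<psi> i)"
    by (simp only: hcomp_sum hcomp_mult[OF e(1)])
  also have "\<dots> = 0"
    using e(2) by (intro sum.neutral ballI) (simp add: homog_negative[OF homog_hcomp])
  finally show ?thesis using coef_hcomp[of 0 f 0] by (simp add: mdeg_def)
qed

text \<open>An invariant is a polynomial in the \<open>\<psi> i\<close>, and modulo the ideal only
  its constant term survives. In particular invariants without constant term lie in the
  ideal.\<close>

lemma invariant_mod_psi_ideal:
  assumes "f \<in> invariants G"
  shows "f - coef f 0 *\<^sub>R 1 \<in> psi_ideal \<psi>"
proof -
  have "\<exists>c. peval \<psi> p - c *\<^sub>R 1 \<in> psi_ideal \<psi>" for p
  proof (induction p rule: rpoly_induct)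
    case (add f g)
    then obtain c d where "peval \<psi> f - c *\<^sub>R 1 \<in> psi_ideal \<psi>" "peval \<psi> g - d *\<^sub>R 1 \<in> psi_ideal \<psi>"
      by blast
    then have "(peval \<psi> f - c *\<^sub>R 1) + (peval \<psi> g - d *\<^sub>R 1) \<in> psi_ideal \<psi>"
      by (rule psi_ideal_add)
    then show ?case by (intro exI[of _ "c + d"]) (simp add: peval_add algebra_simps)
  next
    case (scale a f)
    then obtain c where "peval \<psi> f - c *\<^sub>R 1 \<in> psi_ideal \<psi>" by blast
    from psi_ideal_scaleR[OF this, of a] show ?case
      by (intro exI[of _ "a * c"]) (simp add: peval_scaleR algebra_simps)
  next
    case one
    show ?case by (rule exI[of _ 1]) simp
  next
    case (var i f)
    have "peval \<psi> f * \<psi> i \<in> psi_ideal \<psi>" by (intro psi_ideal_mult psi_ideal_generator)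
    then show ?case by (intro exI[of _ 0]) (simp add: peval_mult mult.commute)
  qed
  then obtain c where c: "f - c *\<^sub>R 1 \<in> psi_ideal \<psi>"
    using assms by (metis invariant_eq_peval)
  from coef_0_psi_ideal[OF this] have "c = coef f 0" by (simp add: lookup_minus)
  with c show ?thesis by simp
qed

text \<open>Dividing the relation by the linear form of a reflection lowers the
  degree of \<open>h p\<close>, so \<open>h p\<close> is fixed modulo the ideal by every reflection.\<close>

lemma chevalley:
  assumes "finite T" "p \<notin> T" "\<And>t. t \<in> insert p T \<Longrightarrow> g t \<in> invariants G"
    and "\<nexists>r. (\<forall>t\<in>T. r t \<in> invariants G) \<and> g p = (\<Sum>t\<in>T. r t * g t)"
    and "homog (int e) (h p)" "(\<Sum>t\<in>insert p T. g t * h t) = 0"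
  shows "h p \<in> psi_ideal \<psi>"
  using assms(5,6)
proof (induction e arbitrary: h)
  case 0
  define c where "c = coef (h p) 0"
  have hp: "h p = c *\<^sub>R 1" unfolding c_def using 0 by (intro homog_0_const) simp
  show ?case
  proof (cases "c = 0")
    case False
    \<comment> \<open>Averaging leaves the constant \<open>h p\<close> alone and makes the other
      \<open>h t\<close> invariant; dividing by \<open>c\<close> would then express
      \<open>g p\<close> through the other \<open>g t\<close>, which is excluded.\<close>
    have "reynolds G (\<Sum>t\<in>insert p T. g t * h t) = (\<Sum>t\<in>insert p T. g t * reynolds G (h t))"
      unfolding reynolds_sum by (rule sum.cong) (use assms(3) in \<open>auto simp: reynolds_mult\<close>)
    then have "c *\<^sub>R g p + (\<Sum>t\<in>T. g t * reynolds G (h t)) = 0"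
      using 0(2) assms(1,2)
      by (simp add: hp reynolds_scaleR reynolds_of_invariant)
    then have "c *\<^sub>R g p = - (\<Sum>t\<in>T. g t * reynolds G (h t))" by (simp add: eq_neg_iff_add_eq_0)
    then have "(1 / c) *\<^sub>R (c *\<^sub>R g p) = (1 / c) *\<^sub>R (- (\<Sum>t\<in>T. g t * reynolds G (h t)))" by simp
    with False have "g p = (\<Sum>t\<in>T. (- (1 / c) *\<^sub>R reynolds G (h t)) * g t)"
      by (simp add: scaleR_sum_right sum_negf mult.commute)
    moreover have "\<forall>t\<in>T. - (1 / c) *\<^sub>R reynolds G (h t) \<in> invariants G"
      by (intro ballI invariants_scaleR reynolds_invariant)
    ultimately have "\<exists>r. (\<forall>t\<in>T. r t \<in> invariants G) \<and> g p = (\<Sum>t\<in>T. r t * g t)"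
      by (intro exI[of _ "\<lambda>t. - (1 / c) *\<^sub>R reynolds G (h t)"] conjI)
    with assms(4) show ?thesis by contradiction
  qed (simp add: hp)
next
  case (Suc e)
  have refl: "h p - poly_act A (h p) \<in> psi_ideal \<psi>" if A: "A \<in> G" "reflection A" for A
  proof -
    obtain l where l: "l \<noteq> 0" "homog 1 l" "\<And>f. \<exists>k. f - poly_act A f = l * k"
      using reflection_divided_difference[OF A(2)] by blast
    define k where "k t = (SOME k. h t - poly_act A (h t) = l * k)" for t
    have k: "h t - poly_act A (h t) = l * k t" for t
      unfolding k_def by (rule someI_ex) (rule l(3))
    have "poly_act A (\<Sum>t\<in>insert p T. g t * h t) = (\<Sum>t\<in>insert p T. g t * poly_act A (h t))"
      unfolding poly_act_sum poly_act_mult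
      by (rule sum.cong) (use A in \<open>simp_all add: invariantsD[OF assms(3)]\<close>)
    with Suc.prems(2) have "(\<Sum>t\<in>insert p T. g t * (h t - poly_act A (h t))) = 0"
      by (simp only: right_diff_distrib sum_subtractf) simp
    then have "l * (\<Sum>t\<in>insert p T. g t * k t) = 0"
      unfolding k by (simp only: sum_distrib_left mult.left_commute[of l])
    \<comment> \<open>Since polynomials have no zero divisors, \<open>l\<close> cancels and the
      quotients \<open>k t\<close> satisfy the same relation.\<close>
    with l(1) have rel: "(\<Sum>t\<in>insert p T. g t * k t) = 0" by simp
    \<comment> \<open>\<open>l * k p\<close> is homogeneous, hence equal to its component of degree
      \<open>Suc e\<close>; cancelling \<open>l\<close> shows that \<open>k p\<close> equals its
      component of degree \<open>e\<close>.\<close>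
    have "homog (int (Suc e)) (h p - poly_act A (h p))"
      using Suc.prems(1) by (intro homog_diff homog_poly_act)
    then have "k p * l = hcomp (int (Suc e)) (k p * l)"
      by (simp add: k hcomp_homog mult.commute)
    also have "\<dots> = hcomp (int e) (k p) * l" by (simp add: hcomp_mult[OF l(2)])
    finally have "(k p - hcomp (int e) (k p)) * l = 0" by (simp add: algebra_simps)
    with l(1) have "k p = hcomp (int e) (k p)" by simp
    then have "homog (int e) (k p)" by (metis homog_hcomp)
    from Suc.IH[OF this rel] show ?thesis unfolding k by (rule psi_ideal_mult)
  qed
  \<comment> \<open>The elements of \<open>G\<close> that fix \<open>h p\<close> modulo the ideal
    are closed under products, because the ideal is stable under \<open>G\<close>; so it suffices to
    know this for reflections.\<close>
  have all: "A \<in> G \<and> h p - poly_act A (h p) \<in> psi_ideal \<psi>"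
    if "A \<in> generate GL {A \<in> G. reflection A}" for A
    using that
  proof induction
    case one
    then show ?case using one_closed by (simp add: GL_def)
  next
    case (incl A)
    then show ?case using refl by simp
  next
    case (inv A)
    then have "inv\<^bsub>GL\<^esub> A = A" by (simp add: inv_GL G_invertible reflection_matrix_inv)
    with inv show ?case using refl by simp
  next
    case (eng A B)
    have AB: "A \<otimes>\<^bsub>GL\<^esub> B = A ** B" by (simp add: GL_def)
    have "(h p - poly_act A (h p)) + poly_act A (h p - poly_act B (h p)) \<in> psi_ideal \<psi>"
      using eng by (intro psi_ideal_add psi_ideal_act) auto
    moreover have "h p - poly_act (A ** B) (h p)
        = (h p - poly_act A (h p)) + poly_act A (h p - poly_act B (h p))"
      using eng by (simp add: act_comp poly_act_diff)
    ultimately have "h p - poly_act (A ** B) (h p) \<in> psi_ideal \<psi>" by (simp only:)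
    with eng show ?case by (simp add: AB mult_closed)
  qed
  \<comment> \<open>\<open>h p\<close> is congruent to its average, and the average, an invariant of
    positive degree, lies in the ideal.\<close>
  have "reynolds G (h p) - coef (reynolds G (h p)) 0 *\<^sub>R 1 \<in> psi_ideal \<psi>"
    by (intro invariant_mod_psi_ideal reynolds_invariant)
  then have R: "reynolds G (h p) \<in> psi_ideal \<psi>"
    using coef_0_homog[OF homog_reynolds[OF Suc.prems(1)]] by simp
  have "h p - reynolds G (h p) = (1 / real (card G)) *\<^sub>R (\<Sum>A\<in>G. h p - poly_act A (h p))"
    using card_G by (simp add: reynolds_def sum_subtractf scaleR_diff_right sum_constant_scaleR
        del: sum_constant)
  also have "\<dots> \<in> psi_ideal \<psi>"
    using all generate_G by (intro psi_ideal_scaleR psi_ideal_sum) auto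
  finally show ?case using psi_ideal_add[OF _ R] by fastforce
qed

text \<open>Since \<open>h p\<close> is not in the ideal, \<open>chevalley\<close> writes
  \<open>g p\<close> through the remaining \<open>g t\<close>. Substituting this removes
  \<open>p\<close> from the relation at the price of changing the \<open>h t\<close>, which keep
  their degrees and their independence; hence the induction is over all \<open>h\<close>.\<close>

lemma invariants_free_homog:
  fixes h :: "'t \<Rightarrow> 'n rpoly"
  assumes "finite T" "\<And>t. t \<in> T \<Longrightarrow> g t \<in> invariants G"
    and "\<And>t. t \<in> T \<Longrightarrow> homog (D - int (dg t)) (g t)" "\<And>t. t \<in> T \<Longrightarrow> homog (int (dg t)) (h t)"
    and "\<And>c t. (\<Sum>t\<in>T. c t *\<^sub>R h t) \<in> psi_ideal \<psi> \<Longrightarrow> t \<in> T \<Longrightarrow> c t = 0"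
    and "(\<Sum>t\<in>T. g t * h t) = 0" "t \<in> T"
  shows "g t = 0"
  using assms
proof (induction T arbitrary: h t rule: finite_induct)
  case (insert p T)
  have "h p \<notin> psi_ideal \<psi>"
  proof
    assume "h p \<in> psi_ideal \<psi>"
    moreover have "(\<Sum>t\<in>insert p T. (if t = p then 1 else 0 :: real) *\<^sub>R h t) = h p"
      using insert.hyps by (simp add: if_distrib[of "\<lambda>c. c *\<^sub>R _"] cong: if_cong)
    ultimately show False
      using insert.prems(4)[of "\<lambda>t. if t = p then 1 else 0" p] by simp
  qed
  then have "\<exists>r. (\<forall>t\<in>T. r t \<in> invariants G) \<and> g p = (\<Sum>t\<in>T. r t * g t)"
    using chevalley[of T p g "dg p" h] insert.hyps insert.prems by blast
  then obtain r where r: "\<And>t. t \<in> T \<Longrightarrow> r t \<in> invariants G" "g p = (\<Sum>t\<in>T. r t * g t)" by blast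
  \<comment> \<open>The degrees \<open>D - dg p\<close> of \<open>g p\<close> and
    \<open>D - dg t\<close> of \<open>g t\<close> dictate the degree of the coefficient. If it is
    negative, \<open>q t\<close> is zero.\<close>
  define q where "q t = hcomp (int (dg t) - int (dg p)) (r t)" for t
  have q_inv: "q t \<in> invariants G" if "t \<in> T" for t
    using r(1)[OF that] by (simp add: q_def invariants_hcomp)
  have "hcomp (D - int (dg p)) (g p) = (\<Sum>t\<in>T. q t * g t)"
    unfolding r(2) hcomp_sum
  proof (rule sum.cong)
    fix t assume "t \<in> T"
    with hcomp_mult[OF insert.prems(2)[of t], of "D - int (dg p)" "r t"]
    show "hcomp (D - int (dg p)) (r t * g t) = q t * g t" by (simp add: q_def)
  qed simp
  then have gp: "g p = (\<Sum>t\<in>T. q t * g t)"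
    using hcomp_homog[OF insert.prems(2)[of p], of "D - int (dg p)"] by simp
  \<comment> \<open>What multiplies \<open>g t\<close> after the substitution of
    \<open>g p\<close>.\<close>
  define h' where "h' t = h t + q t * h p" for t
  have rel: "(\<Sum>t\<in>T. g t * h' t) = 0"
  proof -
    have "(\<Sum>t\<in>T. g t * h' t) = g p * h p + (\<Sum>t\<in>T. g t * h t)"
      by (simp add: h'_def gp distrib_left sum.distrib sum_distrib_left ac_simps)
    with insert.prems(5) insert.hyps show ?thesis by simp
  qed
  have h'_homog: "homog (int (dg t)) (h' t)" if "t \<in> T" for t
    unfolding h'_def q_def
  proof (rule homog_add)
    show "homog (int (dg t)) (h t)" using insert.prems(3) that by simp
    show "homog (int (dg t)) (hcomp (int (dg t) - int (dg p)) (r t) * h p)"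
      using homog_mult[OF homog_hcomp insert.prems(3)[of p],
          of "int (dg t) - int (dg p)" "r t"] by simp
  qed
  have h'_indep: "c t = 0" if c: "(\<Sum>t\<in>T. c t *\<^sub>R h' t) \<in> psi_ideal \<psi>" "t \<in> T" for c t
  proof -
    \<comment> \<open>Modulo the ideal the invariant \<open>q t\<close> is its constant term, so a
      combination of the \<open>h' t\<close> is congruent to one of the \<open>h t\<close> in which
      \<open>h p\<close> collects these constants.\<close>
    define b where "b t = (if t = p then \<Sum>t\<in>T. c t * coef (q t) 0 else c t)" for t
    have "(\<Sum>t\<in>insert p T. b t *\<^sub>R h t)
        = (\<Sum>t\<in>T. c t *\<^sub>R h' t) - (\<Sum>t\<in>T. h p * (c t *\<^sub>R (q t - coef (q t) 0 *\<^sub>R 1)))"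
    proof -
      have "(\<Sum>t\<in>T. b t *\<^sub>R h t) = (\<Sum>t\<in>T. c t *\<^sub>R h t)"
        using insert.hyps by (intro sum.cong) (auto simp: b_def)
      moreover have "b p = (\<Sum>t\<in>T. c t * coef (q t) 0)" by (simp add: b_def)
      ultimately show ?thesis
        using insert.hyps
        by (simp add: h'_def scaleR_sum_left scaleR_add_right scaleR_diff_right right_diff_distrib
            sum.distrib sum_subtractf mult.commute)
    qed
    also have "\<dots> \<in> psi_ideal \<psi>"
      by (rule psi_ideal_diff[OF c(1)])
        (intro psi_ideal_sum psi_ideal_mult psi_ideal_scaleR invariant_mod_psi_ideal q_inv)
    finally have "b t = 0" using insert.prems(4)[of b t] c(2) by simp
    moreover have "t \<noteq> p" using c(2) insert.hyps by auto
    ultimately show ?thesis by (simp add: b_def)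
  qed
  have T0: "g t = 0" if "t \<in> T" for t
    by (rule insert.IH[of h' t]) (use insert.prems rel h'_homog h'_indep that in auto)
  show ?case
  proof (cases "t = p")
    case True
    with gp T0 show ?thesis by simp
  next
    case False
    with insert.prems(6) T0 show ?thesis by simp
  qed
qed simp

lemma invariants_free:
  fixes h :: "'t \<Rightarrow> 'n rpoly"
  assumes T: "finite T" and g: "\<And>t. t \<in> T \<Longrightarrow> g t \<in> invariants G"
    and h: "\<And>t. t \<in> T \<Longrightarrow> homog (int (dg t)) (h t)"
    and indep: "\<And>c t. (\<Sum>t\<in>T. c t *\<^sub>R h t) \<in> psi_ideal \<psi> \<Longrightarrow> t \<in> T \<Longrightarrow> c t = 0"
    and rel: "(\<Sum>t\<in>T. g t * h t) = 0" and t: "t \<in> T"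
  shows "g t = 0"
proof (rule poly_mapping_eqI)
  fix m :: "'n \<Rightarrow>\<^sub>0 nat"
  \<comment> \<open>The degree to which the term of \<open>g t\<close> with monomial
    \<open>m\<close> contributes; taking components of degree \<open>D\<close> reduces the claim to
    the homogeneous case.\<close>
  define D where "D = int (mdeg m) + int (dg t)"
  have "hcomp D (\<Sum>t\<in>T. g t * h t) = (\<Sum>t\<in>T. hcomp (D - int (dg t)) (g t) * h t)"
    unfolding hcomp_sum by (rule sum.cong) (simp_all add: hcomp_mult[OF h])
  with rel have "(\<Sum>t\<in>T. hcomp (D - int (dg t)) (g t) * h t) = 0" by simp
  then have "hcomp (D - int (dg t)) (g t) = 0"
    using invariants_free_homog[of T "\<lambda>t. hcomp (D - int (dg t)) (g t)" D dg h t]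
      T g h indep t by (simp add: invariants_hcomp)
  then have "coef (hcomp (int (mdeg m)) (g t)) m = 0" by (simp add: D_def)
  then show "coef (g t) m = coef 0 m" by (simp add: coef_hcomp)
qed

text \<open>By induction on the degree: in \<open>f = x + (\<Sum>i. a i * \<psi> i)\<close> the
  relevant components of the \<open>a i\<close> have smaller degree than \<open>f\<close>, because
  every \<open>\<psi> i\<close> has positive degree.\<close>

lemma graded_nakayama:
  assumes S: "\<And>f. \<exists>x\<in>S. f - x \<in> psi_ideal \<psi>"
    and hcomp_S: "\<And>x d. x \<in> S \<Longrightarrow> hcomp d x \<in> M"
    and zero: "0 \<in> M" and add: "\<And>x y. x \<in> M \<Longrightarrow> y \<in> M \<Longrightarrow> x + y \<in> M"
    and mult: "\<And>g x. g \<in> invariants G \<Longrightarrow> x \<in> M \<Longrightarrow> g * x \<in> M"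
  shows "f \<in> M"
proof -
  obtain e where e: "\<And>i. homog (e i) (\<psi> i)" "\<And>i. e i > 0" by (rule psi_homog) blast
  have sum: "sum F K \<in> M" if "\<And>k. k \<in> K \<Longrightarrow> F k \<in> M" for F and K :: "'k set"
    using that by (induction K rule: infinite_finite_induct) (simp_all add: zero add)
  have hom: "f \<in> M" if "homog (int d) f" for d f
    using that
  proof (induction d arbitrary: f rule: less_induct)
    case (less d)
    obtain x where x: "x \<in> S" "f - x \<in> psi_ideal \<psi>" using S by blast
    obtain a where a: "f - x = (\<Sum>i\<in>UNIV. a i * \<psi> i)" using x(2) by (rule psi_idealE)
    have "hcomp (int d) f = hcomp (int d) (x + (\<Sum>i\<in>UNIV. a i * \<psi> i))"
      using a by (simp add: algebra_simps)
    then have f: "f = hcomp (int d) x + (\<Sum>i\<in>UNIV. \<psi> i * hcomp (int d - e i) (a i))"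
      unfolding mult.commute[of "\<psi> _"]
      using less.prems by (simp add: hcomp_homog hcomp_add hcomp_sum hcomp_mult[OF e(1)])
    have "\<psi> i * hcomp (int d - e i) (a i) \<in> M" for i
    proof (cases "e i \<le> int d")
      case True
      then have "homog (int (nat (int d - e i))) (hcomp (int d - e i) (a i))" by simp
      moreover have "nat (int d - e i) < d" using True e(2)[of i] by linarith
      ultimately have "hcomp (int d - e i) (a i) \<in> M" using less.IH by blast
      then show ?thesis using mult psi_invariant by blast
    next
      case False
      then have "hcomp (int d - e i) (a i) = 0" by (intro homog_negative[OF homog_hcomp]) simp
      then show ?thesis by (simp add: zero)
    qed
    then show ?case by (subst f) (intro add sum hcomp_S x(1))
  qed
  have "hcomp d f \<in> M" for d
  proof (cases "d \<ge> 0")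
    case True
    then show ?thesis using hom[of "nat d" "hcomp d f"] by simp
  next
    case False
    then have "hcomp d f = 0" by (intro homog_negative[OF homog_hcomp]) simp
    then show ?thesis by (simp add: zero)
  qed
  moreover obtain D where "finite D" "\<And>m. coef f m \<noteq> 0 \<Longrightarrow> int (mdeg m) \<in> D"
    by (rule finite_degrees) blast
  then have "f = (\<Sum>d\<in>D. hcomp d f)" by (rule sum_hcomp)
  ultimately show ?thesis using sum by metis
qed

end


section \<open>Invariant forms and Schur's lemma\<close>

lemma orthonormal_expansion:
  fixes B :: "'a::real_vector \<Rightarrow> 'a \<Rightarrow> real"
  assumes lin: "\<And>x. linear (B x)" and E: "finite E"
    and ortho: "\<And>e e'. e \<in> E \<Longrightarrow> e' \<in> E \<Longrightarrow> B e e' = (if e = e' then 1 else 0)"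
    and x: "x \<in> span E"
  shows "x = (\<Sum>e\<in>E. B e x *\<^sub>R e)"
proof -
  obtain u where u: "x = (\<Sum>e\<in>E. u e *\<^sub>R e)" using x E by (auto simp: span_finite)
  have "B e x = u e" if e: "e \<in> E" for e
  proof -
    have "B e x = (\<Sum>e'\<in>E. u e' * B e e')"
      unfolding u by (simp add: linear_sum[OF lin] linear_scale[OF lin])
    also have "\<dots> = (\<Sum>e'\<in>E. if e = e' then u e' else 0)"
      by (rule sum.cong) (simp_all add: ortho e)
    finally show ?thesis using E e by simp
  qed
  then have "(\<Sum>e\<in>E. B e x *\<^sub>R e) = (\<Sum>e\<in>E. u e *\<^sub>R e)" by (intro sum.cong) simp_all
  with u show ?thesis by simp
qed

text \<open>Gram-Schmidt for a form given as a function, since the inner product in use depends on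
  \<open>G\<close>. The vector \<open>p\<close> is the projection of \<open>b\<close> to the span of
  \<open>E\<close>.\<close>

lemma orthonormal_spanning_set:
  fixes B :: "'a::real_vector \<Rightarrow> 'a \<Rightarrow> real"
  assumes lin: "\<And>x. linear (B x)" and sym: "\<And>x y. B x y = B y x"
    and pos: "\<And>x. x \<noteq> 0 \<Longrightarrow> B x x > 0" and S: "finite S"
  shows "\<exists>E. finite E \<and> span E = span S \<and>
    (\<forall>e\<in>E. \<forall>e'\<in>E. B e e' = (if e = e' then 1 else 0))"
  using S
proof (induction S rule: finite_induct)
  case empty
  show ?case by (rule exI[of _ "{}"]) simp
next
  case (insert b S)
  then obtain E where E: "finite E" "span E = span S"
    "\<And>e e'. e \<in> E \<Longrightarrow> e' \<in> E \<Longrightarrow> B e e' = (if e = e' then 1 else 0)" by blast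
  define p where "p = (\<Sum>e\<in>E. B e b *\<^sub>R e)"
  have p: "p \<in> span E" unfolding p_def by (intro span_sum span_scale span_base)
  show ?case
  proof (cases "b = p")
    case True
    with p E(2) have "span (insert b S) = span S" by (metis span_redundant)
    with E show ?thesis by auto
  next
    case False
    define n where "n = sqrt (B (b - p) (b - p))"
    define u where "u = (1 / n) *\<^sub>R (b - p)"
    have pos': "B (b - p) (b - p) > 0" using False by (intro pos) simp
    then have n: "n > 0" "n * n = B (b - p) (b - p)" by (simp_all add: n_def)
    have uu: "B u u = 1"
    proof -
      have "B u u = (1 / n) * B (b - p) u"
        by (metis u_def linear_scale[OF lin] sym real_scaleR_def)
      also have "B (b - p) u = (1 / n) * B (b - p) (b - p)"
        by (simp add: u_def linear_scale[OF lin])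
      finally show ?thesis using n(1) by (simp flip: n(2))
    qed
    have eu: "B e u = 0" if e: "e \<in> E" for e
    proof -
      have "B e p = (\<Sum>e'\<in>E. if e = e' then B e' b else 0)"
        unfolding p_def linear_sum[OF lin] linear_scale[OF lin]
        by (rule sum.cong) (simp_all add: E(3) e)
      then have "B e p = B e b" using E(1) e by simp
      then show ?thesis by (simp add: u_def linear_scale[OF lin] linear_diff[OF lin])
    qed
    have ue: "B u e = 0" if "e \<in> E" for e using eu[OF that] sym by metis
    have notin: "u \<notin> E" using eu[of u] uu by auto
    have "b = n *\<^sub>R u + p" using n(1) by (simp add: u_def)
    moreover have "p \<in> span (insert u E)" using p span_mono[of E "insert u E"] by auto
    ultimately have "b \<in> span (insert u E)"
      by (metis insertI1 span_add span_base span_scale)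
    moreover have "S \<subseteq> span (insert u E)"
      using E(2) span_mono[of E "insert u E"] span_superset[of S] by auto
    ultimately have "span (insert b S) \<subseteq> span (insert u E)" by (intro span_minimal) auto
    moreover have "span (insert u E) \<subseteq> span (insert b S)"
    proof (rule span_minimal)
      have sub: "span E \<subseteq> span (insert b S)" using E(2) span_mono[of S "insert b S"] by auto
      moreover have "p \<in> span (insert b S)" using p sub by auto
      then have "u \<in> span (insert b S)"
        unfolding u_def by (intro span_scale span_diff) (auto intro: span_base)
      ultimately show "insert u E \<subseteq> span (insert b S)" using span_superset[of E] by auto
    qed simp
    ultimately have "span (insert u E) = span (insert b S)" by simp
    moreover have "\<forall>e\<in>insert u E. \<forall>e'\<in>insert u E. B e e' = (if e = e' then 1 else 0)"
      using E(3) uu eu ue notin by auto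
    ultimately show ?thesis using E(1) by blast
  qed
qed

section \<open>Inner products, equivariant maps and Schur's lemma\<close>

definition coef_dot :: "'m::finite rpoly \<Rightarrow> 'm rpoly \<Rightarrow> real" where
  "coef_dot f g = (\<Sum>m\<in>Poly_Mapping.keys f. coef f m * coef g m)"

lemma linear_coef_dot: "linear (coef_dot f)"
  by (rule linearI)
    (simp_all add: coef_dot_def lookup_add distrib_left sum.distrib sum_distrib_left ac_simps)

lemma coef_dot_sym: "coef_dot f g = coef_dot g f"
proof -
  have "coef_dot f g = (\<Sum>m\<in>Poly_Mapping.keys f \<union> Poly_Mapping.keys g. coef f m * coef g m)"
    for f g :: "'a rpoly"
    unfolding coef_dot_def by (rule sum.mono_neutral_left) (auto simp: in_keys_iff)
  from this[of f g] this[of g f] show ?thesis by (simp add: Un_commute mult.commute)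
qed

lemma coef_dot_nonneg: "coef_dot f f \<ge> 0"
  by (simp add: coef_dot_def sum_nonneg)

lemma coef_dot_pos: "f \<noteq> 0 \<Longrightarrow> coef_dot f f > 0"
  unfolding coef_dot_def
  by (rule sum_pos) (auto simp: in_keys_iff zero_less_mult_iff linorder_neq_iff)

text \<open>All conditions are relative to \<open>V\<close>, because nothing is known about the maps
  from \<open>gmodule_iso\<close> outside the carrier. The same reason shapes
  \<open>invariant_form\<close>.\<close>

definition equivariant :: "(real^'n^'n) set \<Rightarrow> 'n rpoly set \<Rightarrow> ('n rpoly \<Rightarrow> 'n rpoly) \<Rightarrow> bool" where
  "equivariant G V T \<longleftrightarrow> (\<forall>x\<in>V. \<forall>y\<in>V. T (x + y) = T x + T y) \<and>
     (\<forall>c. \<forall>x\<in>V. T (c *\<^sub>R x) = c *\<^sub>R T x) \<and> (\<forall>A\<in>G. \<forall>x\<in>V. T (poly_act A x) = poly_act A (T x))"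

definition stable_subspace :: "(real^'n^'n) set \<Rightarrow> 'n rpoly set \<Rightarrow> bool" where
  "stable_subspace G V \<longleftrightarrow> subspace V \<and> (\<forall>A\<in>G. \<forall>x\<in>V. poly_act A x \<in> V)"

definition irreducible_subspace :: "(real^'n^'n) set \<Rightarrow> 'n rpoly set \<Rightarrow> bool" where
  "irreducible_subspace G V \<longleftrightarrow> stable_subspace G V \<and> V \<noteq> {0} \<and>
     (\<forall>N. stable_subspace G N \<and> N \<subseteq> V \<longrightarrow> N = {0} \<or> N = V)"

definition invariant_form ::
    "(real^'n^'n) set \<Rightarrow> 'n rpoly set \<Rightarrow> 'n rpoly set \<Rightarrow> ('n rpoly \<Rightarrow> 'n rpoly \<Rightarrow> real) \<Rightarrow> bool" where
  "invariant_form G V W B \<longleftrightarrow>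
     (\<forall>x\<in>V. \<forall>x'\<in>V. \<forall>y\<in>W. B (x + x') y = B x y + B x' y) \<and>
     (\<forall>c. \<forall>x\<in>V. \<forall>y\<in>W. B (c *\<^sub>R x) y = c * B x y) \<and>
     (\<forall>x\<in>V. \<forall>y\<in>W. \<forall>y'\<in>W. B x (y + y') = B x y + B x y') \<and>
     (\<forall>c. \<forall>x\<in>V. \<forall>y\<in>W. B x (c *\<^sub>R y) = c * B x y) \<and>
     (\<forall>A\<in>G. \<forall>x\<in>V. \<forall>y\<in>W. B (poly_act A x) (poly_act A y) = B x y)"

lemma equivariantD:
  assumes "equivariant G V T"
  shows "x \<in> V \<Longrightarrow> y \<in> V \<Longrightarrow> T (x + y) = T x + T y"
    and "x \<in> V \<Longrightarrow> T (c *\<^sub>R x) = c *\<^sub>R T x"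
    and "A \<in> G \<Longrightarrow> x \<in> V \<Longrightarrow> T (poly_act A x) = poly_act A (T x)"
  using assms by (auto simp: equivariant_def)

lemma equivariant_zero:
  assumes "equivariant G V T" "subspace V"
  shows "T 0 = 0"
  using equivariantD(2)[OF assms(1), of 0 0] assms(2) by (simp add: subspace_0)

lemma equivariant_sum:
  assumes T: "equivariant G V T" and V: "subspace V" and x: "\<And>k. k \<in> K \<Longrightarrow> x k \<in> V"
  shows "T (\<Sum>k\<in>K. c k *\<^sub>R x k) = (\<Sum>k\<in>K. c k *\<^sub>R T (x k))"
  using x
proof (induction K rule: infinite_finite_induct)
  case (insert k K)
  have "(\<Sum>k\<in>K. c k *\<^sub>R x k) \<in> V" using insert.prems by (intro subspace_sum[OF V] subspace_scale[OF V]) simp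
  moreover have "c k *\<^sub>R x k \<in> V" using insert.prems by (intro subspace_scale[OF V]) simp
  ultimately show ?case using insert by (simp add: equivariantD[OF T])
qed (simp_all add: equivariant_zero[OF T V])

definition orbit_span :: "(real^'n^'n) set \<Rightarrow> 'n rpoly \<Rightarrow> 'n rpoly set" where
  "orbit_span G f = span ((\<lambda>A. poly_act A f) ` G)"

lemma subspace_orbit_span [simp]: "subspace (orbit_span G f)"
  by (simp add: orbit_span_def)

lemma homog_orbit_span:
  assumes "homog d f" "x \<in> orbit_span G f"
  shows "homog d x"
proof -
  have "x \<in> span ((\<lambda>A. poly_act A f) ` G)" using assms(2) by (simp add: orbit_span_def)
  then show ?thesis
    by (induction rule: span_induct_alt)
      (use assms(1) in \<open>auto intro!: homog_add homog_scaleR homog_poly_act\<close>)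
qed

context finite_matrix_group
begin

lemma self_in_orbit_span: "f \<in> orbit_span G f"
  unfolding orbit_span_def
  by (rule span_base, rule image_eqI[of _ _ "Finite_Cartesian_Product.mat 1"]) (simp_all add: one_closed)

lemma orbit_span_stable: "stable_subspace G (orbit_span G f)"
  unfolding stable_subspace_def
proof (intro conjI ballI)
  fix A x assume A: "A \<in> G" and "x \<in> orbit_span G f"
  then have "poly_act A x \<in> poly_act A ` span ((\<lambda>A. poly_act A f) ` G)" by (auto simp: orbit_span_def)
  also have "\<dots> = span (poly_act A ` (\<lambda>A. poly_act A f) ` G)"
    by (rule linear_span_image[OF linear_poly_act, symmetric])
  also have "poly_act A ` (\<lambda>A. poly_act A f) ` G \<subseteq> (\<lambda>A. poly_act A f) ` G"
    using A by (force simp: mult_closed simp flip: act_comp)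
  then have "span (poly_act A ` (\<lambda>A. poly_act A f) ` G) \<subseteq> orbit_span G f"
    unfolding orbit_span_def by (rule span_mono)
  finally show "poly_act A x \<in> orbit_span G f" .
qed simp

text \<open>Summation over \<open>G\<close> turns the Euclidean product of coefficients into an
  invariant one; normalising it is pointless, as only ratios of its values matter.\<close>

definition ip :: "'n rpoly \<Rightarrow> 'n rpoly \<Rightarrow> real" where
  "ip f g = (\<Sum>A\<in>G. coef_dot (poly_act A f) (poly_act A g))"

lemma linear_ip: "linear (ip f)"
  by (rule linearI)
    (simp_all add: ip_def poly_act_add poly_act_scaleR linear_add[OF linear_coef_dot]
      linear_scale[OF linear_coef_dot] sum.distrib sum_distrib_left)

lemma ip_sym: "ip f g = ip g f"
  by (simp add: ip_def coef_dot_sym)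

lemma ip_pos:
  assumes "f \<noteq> 0"
  shows "ip f f > 0"
  unfolding ip_def
proof (rule sum_pos2[OF finite_G one_closed])
  show "0 < coef_dot (poly_act (Finite_Cartesian_Product.mat 1) f)
      (poly_act (Finite_Cartesian_Product.mat 1) f)"
    using assms by (simp add: coef_dot_pos)
qed (simp add: coef_dot_nonneg)

lemma ip_act: "A \<in> G \<Longrightarrow> ip (poly_act A f) (poly_act A g) = ip f g"
  using sum_mult_right[of A "\<lambda>B. coef_dot (poly_act B f) (poly_act B g)"]
  by (simp add: ip_def act_comp)

lemma orthonormal_basis_orbit_span:
  obtains E where "finite E" "span E = orbit_span G f"
    "\<And>e e'. e \<in> E \<Longrightarrow> e' \<in> E \<Longrightarrow> ip e e' = (if e = e' then 1 else 0)"
  using orthonormal_spanning_set[of ip "(\<lambda>A. poly_act A f) ` G"] finite_G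
  by (auto simp: orbit_span_def linear_ip ip_sym ip_pos)

text \<open>Riesz representation with respect to \<open>ip\<close>. As both \<open>B\<close> and
  \<open>ip\<close> are invariant, uniqueness of the representing vector makes \<open>T\<close>
  equivariant, so statements about forms become statements about maps.\<close>

lemma ip_representation:
  assumes B: "invariant_form G V (orbit_span G w) B" and V: "stable_subspace G V"
  obtains T where "equivariant G V T" "\<And>x. x \<in> V \<Longrightarrow> T x \<in> orbit_span G w"
    "\<And>x y. x \<in> V \<Longrightarrow> y \<in> orbit_span G w \<Longrightarrow> ip (T x) y = B x y"
proof -
  obtain E where E: "finite E" "span E = orbit_span G w"
    "\<And>e e'. e \<in> E \<Longrightarrow> e' \<in> E \<Longrightarrow> ip e e' = (if e = e' then 1 else 0)"
    by (rule orthonormal_basis_orbit_span) blast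
  define T where "T x = (\<Sum>e\<in>E. B x e *\<^sub>R e)" for x
  let ?W = "orbit_span G w"
  have EW: "e \<in> ?W" if "e \<in> E" for e using that E(2) span_base by blast
  have TW: "T x \<in> ?W" for x
    unfolding T_def by (intro subspace_sum subspace_scale subspace_orbit_span EW)
  have T: "ip (T x) y = B x y" if x: "x \<in> V" and y: "y \<in> ?W" for x y
  proof -
    have exp: "y = (\<Sum>e\<in>E. ip e y *\<^sub>R e)"
      using E y by (intro orthonormal_expansion linear_ip) auto
    have "B x (\<Sum>e\<in>K. c e *\<^sub>R e) = (\<Sum>e\<in>K. c e * B x e)" if "finite K" "K \<subseteq> E" for K c
      using that
    proof (induction K rule: finite_induct)
      case empty
      have "0 \<in> ?W" by (simp add: subspace_0)
      then have "B x (0 *\<^sub>R 0) = 0 * B x 0" using B x unfolding invariant_form_def by blast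
      then show ?case by simp
    next
      case (insert e K)
      have scale: "c e *\<^sub>R e \<in> ?W" if "e \<in> E" for e
        by (rule subspace_scale[OF subspace_orbit_span EW[OF that]])
      then have "(\<Sum>e\<in>K. c e *\<^sub>R e) \<in> ?W"
        using insert.prems by (intro subspace_sum[OF subspace_orbit_span]) auto
      with scale have "B x (c e *\<^sub>R e + (\<Sum>e\<in>K. c e *\<^sub>R e)) = c e * B x e + B x (\<Sum>e\<in>K. c e *\<^sub>R e)"
        using B x insert.prems EW by (auto simp: invariant_form_def)
      with insert show ?case by simp
    qed
    from this[OF E(1) subset_refl, of "\<lambda>e. ip e y"] exp
    have "B x y = (\<Sum>e\<in>E. ip e y * B x e)" by simp
    also have "\<dots> = ip y (T x)"
      by (simp add: T_def linear_sum[OF linear_ip] linear_scale[OF linear_ip] ip_sym mult.commute)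
    finally show ?thesis by (simp add: ip_sym)
  qed
  have unique: "z = z'" if "z \<in> ?W" "z' \<in> ?W" "\<And>y. y \<in> ?W \<Longrightarrow> ip z y = ip z' y" for z z'
  proof (rule ccontr)
    assume "z \<noteq> z'"
    then have "ip (z - z') (z - z') > 0" by (intro ip_pos) simp
    moreover have "ip (z - z') (z - z') = ip z (z - z') - ip z' (z - z')"
      using linear_diff[OF linear_ip, of "z - z'" z z'] by (simp add: ip_sym)
    moreover have "z - z' \<in> ?W" using that by (intro subspace_diff subspace_orbit_span)
    ultimately show False using that(3) by simp
  qed
  have stable: "poly_act A y \<in> ?W" if "A \<in> G" "y \<in> ?W" for A y
    using orbit_span_stable that by (auto simp: stable_subspace_def)
  have equi: "T (poly_act A x) = poly_act A (T x)" if A: "A \<in> G" and x: "x \<in> V" for A x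
  proof (rule unique)
    fix y assume y: "y \<in> ?W"
    have Ax: "poly_act A x \<in> V" using V A x by (simp add: stable_subspace_def)
    \<comment> \<open>Writing \<open>y\<close> as a translate lets \<open>A\<close> act on both
      arguments of the form, where invariance removes it.\<close>
    define z where "z = poly_act (matrix_inv A) y"
    have z: "z \<in> ?W" "y = poly_act A z"
      using A y by (simp_all add: z_def stable inv_closed act_inv)
    have "ip (T (poly_act A x)) y = B (poly_act A x) y" using T[OF Ax y] .
    also have "\<dots> = B x z" using B A x z by (simp add: invariant_form_def)
    also have "\<dots> = ip (poly_act A (T x)) y" using T[OF x z(1)] A by (simp add: z(2) ip_act)
    finally show "ip (T (poly_act A x)) y = ip (poly_act A (T x)) y" .
  qed (simp_all add: TW stable A)
  have "T (x + y) = T x + T y" if "x \<in> V" "y \<in> V" for x y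
    unfolding T_def sum.distrib[symmetric] using B that EW
    by (intro sum.cong) (auto simp: invariant_form_def simp flip: scaleR_add_left)
  moreover have "T (c *\<^sub>R x) = c *\<^sub>R T x" if "x \<in> V" for c x
    unfolding T_def scaleR_sum_right using B that EW
    by (intro sum.cong) (auto simp: invariant_form_def)
  ultimately have "equivariant G V T" using equi by (simp add: equivariant_def)
  then show thesis using TW T by (rule that)
qed

text \<open>Kernel and image are stable subspaces. Bijectivity is the alternative that
  \<open>non_iso\<close> excludes for distinct types.\<close>

lemma schur:
  assumes V: "irreducible_subspace G V" and W: "irreducible_subspace G W"
    and T: "equivariant G V T" and TW: "\<And>x. x \<in> V \<Longrightarrow> T x \<in> W"
  shows "(\<forall>x\<in>V. T x = 0) \<or> bij_betw T V W"
proof -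
  have sV: "subspace V" "\<And>A x. A \<in> G \<Longrightarrow> x \<in> V \<Longrightarrow> poly_act A x \<in> V"
    using V by (auto simp: irreducible_subspace_def stable_subspace_def)
  note T0 = equivariant_zero[OF T sV(1)]
  have "stable_subspace G {x \<in> V. T x = 0}"
    unfolding stable_subspace_def subspace_def
    using sV T0 equivariantD[OF T] by (auto simp: subspace_0 subspace_add subspace_scale)
  then have ker: "{x \<in> V. T x = 0} = {0} \<or> {x \<in> V. T x = 0} = V"
    using V unfolding irreducible_subspace_def by blast
  show ?thesis
  proof (cases "{x \<in> V. T x = 0} = V")
    case False
    with ker have inj0: "\<And>x. x \<in> V \<Longrightarrow> T x = 0 \<Longrightarrow> x = 0" by blast
    have inj: "inj_on T V"
    proof (rule inj_onI)
      fix x y assume xy: "x \<in> V" "y \<in> V" "T x = T y"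
      have "T (x + (-1) *\<^sub>R y) = T x + (-1) *\<^sub>R T y"
        using xy sV(1) equivariantD[OF T] by (metis subspace_scale)
      then have "T (x - y) = 0" using xy by simp
      then have "x - y = 0" using inj0 subspace_diff[OF sV(1) xy(1,2)] by blast
      then show "x = y" by simp
    qed
    have "stable_subspace G (T ` V)"
      unfolding stable_subspace_def
    proof (intro conjI ballI subspaceI)
      show "0 \<in> T ` V" using T0 subspace_0[OF sV(1)] by (metis imageI)
    next
      fix x y assume "x \<in> T ` V" "y \<in> T ` V"
      then show "x + y \<in> T ` V"
        using equivariantD(1)[OF T] subspace_add[OF sV(1)] by (metis (no_types, lifting) imageE imageI)
    next
      fix c x assume "x \<in> T ` V"
      then show "c *\<^sub>R x \<in> T ` V"
        using equivariantD(2)[OF T] subspace_scale[OF sV(1)] by (metis (no_types, lifting) imageE imageI)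
    next
      fix A x assume "A \<in> G" "x \<in> T ` V"
      then show "poly_act A x \<in> T ` V"
        using equivariantD(3)[OF T] sV(2) by (metis (no_types, lifting) imageE imageI)
    qed
    moreover have "T ` V \<subseteq> W" using TW by auto
    ultimately have im: "T ` V = {0} \<or> T ` V = W"
      using W unfolding irreducible_subspace_def by blast
    have "T ` V \<noteq> {0}"
    proof
      assume "T ` V = {0}"
      then have "V \<subseteq> {0}" using inj0 by blast
      with subspace_0[OF sV(1)] V show False by (auto simp: irreducible_subspace_def)
    qed
    with im inj show ?thesis by (simp add: bij_betw_def)
  qed blast
qed

end


section \<open>Symmetry adapted bases\<close>

text \<open>The data of a symmetry adapted basis: \<open>\<phi> j i\<close> is the isomorphism from the first copy of
  the \<open>j\<close>-th module to the \<open>i\<close>-th one.\<close>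

locale adapted_basis = reflection_invariants G \<psi>
  for G :: "(real^'n^'n) set" and \<psi> :: "'n \<Rightarrow> 'n rpoly" +
  fixes l :: nat and \<eta> :: "nat \<Rightarrow> nat" and s :: "nat \<Rightarrow> nat \<Rightarrow> 'n rpoly"
    and \<phi> :: "nat \<Rightarrow> nat \<Rightarrow> 'n rpoly \<Rightarrow> 'n rpoly"
  assumes eta_pos: "j < l \<Longrightarrow> 0 < \<eta> j"
    and s_homogeneous: "j < l \<Longrightarrow> i < \<eta> j \<Longrightarrow> homogeneous (s j i)"
    and irred: "j < l \<Longrightarrow> i < \<eta> j \<Longrightarrow> irreducible_subspace G (orbit_span G (s j i))"
    and phi_equi: "j < l \<Longrightarrow> i < \<eta> j \<Longrightarrow> equivariant G (orbit_span G (s j 0)) (\<phi> j i)"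
    and phi_image: "j < l \<Longrightarrow> i < \<eta> j \<Longrightarrow> \<phi> j i ` orbit_span G (s j 0) = orbit_span G (s j i)"
    and phi_s: "j < l \<Longrightarrow> i < \<eta> j \<Longrightarrow> \<phi> j i (s j 0) = s j i"
    and non_iso: "j < l \<Longrightarrow> k < l \<Longrightarrow> j \<noteq> k \<Longrightarrow> equivariant G (orbit_span G (s j 0)) T \<Longrightarrow>
      \<not> bij_betw T (orbit_span G (s j 0)) (orbit_span G (s k 0))"
    and direct: "(\<And>j i. j < l \<Longrightarrow> i < \<eta> j \<Longrightarrow> x (j, i) \<in> orbit_span G (s j i)) \<Longrightarrow>
      (\<Sum>p\<in>index_set l \<eta>. x p) \<in> psi_ideal \<psi> \<Longrightarrow> p \<in> index_set l \<eta> \<Longrightarrow> x p = 0"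
    and spanning: "\<exists>x. (\<forall>j<l. \<forall>i<\<eta> j. x (j, i) \<in> orbit_span G (s j i)) \<and>
      f - (\<Sum>p\<in>index_set l \<eta>. x p) \<in> psi_ideal \<psi>"
    and dim: "j < l \<Longrightarrow> \<exists>b. b ` {..<\<eta> j} \<subseteq> orbit_span G (s j 0) \<and>
      orbit_span G (s j 0) \<subseteq> span (b ` {..<\<eta> j})"
begin

abbreviation W :: "nat \<Rightarrow> 'n rpoly set" where
  "W j \<equiv> orbit_span G (s j 0)"

lemma irred0: "j < l \<Longrightarrow> irreducible_subspace G (W j)"
  by (simp add: irred eta_pos)

lemma W_act: "A \<in> G \<Longrightarrow> x \<in> W j \<Longrightarrow> poly_act A x \<in> W j"
  using orbit_span_stable by (auto simp: stable_subspace_def)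

lemma s_nonzero:
  assumes "j < l" "i < \<eta> j"
  shows "s j i \<noteq> 0"
proof
  assume "s j i = 0"
  then have "orbit_span G (s j i) \<subseteq> {0}"
    unfolding orbit_span_def by (intro span_minimal) auto
  with irred[OF assms] show False
    using subspace_0[OF subspace_orbit_span] by (auto simp: irreducible_subspace_def)
qed

lemma sum_index_set: "(\<Sum>p\<in>index_set l \<eta>. F p) = (\<Sum>j<l. \<Sum>i<\<eta> j. F (j, i))"
  unfolding index_set_def by (simp add: sum.Sigma)

text \<open>Directness of the full sum, applied to a tuple padded with zeros at the other
  types.\<close>

lemma single_copy_independent:
  assumes j: "j < l" and x: "\<And>i. i < \<eta> j \<Longrightarrow> x i \<in> orbit_span G (s j i)"
    and I: "(\<Sum>i<\<eta> j. x i) \<in> psi_ideal \<psi>" and i: "i < \<eta> j"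
  shows "x i = 0"
proof -
  define y where "y = (\<lambda>(k, i). if k = j then x i else 0)"
  have "(\<Sum>p\<in>index_set l \<eta>. y p) = (\<Sum>k<l. if k = j then \<Sum>i<\<eta> j. x i else 0)"
    unfolding sum_index_set by (rule sum.cong) (auto simp: y_def)
  also have "\<dots> = (\<Sum>i<\<eta> j. x i)" using j by simp
  finally have "(\<Sum>p\<in>index_set l \<eta>. y p) \<in> psi_ideal \<psi>" using I by simp
  moreover have "y (k, i) \<in> orbit_span G (s k i)" if "k < l" "i < \<eta> k" for k i
    using x that subspace_0[OF subspace_orbit_span] by (auto simp: y_def)
  ultimately have "y (j, i) = 0" using direct[of y "(j, i)"] i j by (auto simp: index_set_def)
  then show ?thesis by (simp add: y_def)
qed

text \<open>Schur's lemma alone leaves \<open>\<real>\<close>, \<open>\<complex>\<close> or the quaternions as the endomorphism algebra. A non-scalar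
  endomorphism \<open>J\<close> would give \<open>\<eta> j + 1\<close> equivariant maps from a module of dimension at most \<open>\<eta> j\<close>
  to the polynomials, hence a linear relation with polynomial coefficients; averaging makes the
  coefficients invariant, against the freeness over the invariants.\<close>

lemma endomorphism_scalar:
  assumes j: "j < l" and J: "equivariant G (W j) J" and JW: "\<And>x. x \<in> W j \<Longrightarrow> J x \<in> W j"
  shows "\<exists>c. \<forall>x\<in>W j. J x = c *\<^sub>R x"
proof -
  let ?d = "\<eta> j" and ?s = "s j 0"
  have d0: "0 < ?d" using eta_pos[OF j] .
  have sW: "?s \<in> W j" by (rule self_in_orbit_span)
  obtain b where b: "\<And>k. k < ?d \<Longrightarrow> b k \<in> W j" "W j \<subseteq> span (b ` {..<?d})"
    using dim[OF j] by blast
  \<comment> \<open>The last index \<open>?d\<close> carries \<open>J\<close>, which gives one map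
    more than there are spanning vectors \<open>b k\<close>.\<close>
  define F where "F i = (if i < ?d then \<phi> j i else J)" for i
  have F: "equivariant G (W j) (F i)" for i
    using phi_equi[OF j] J by (simp add: F_def)
  obtain a where a: "\<exists>i\<in>{..?d}. a i \<noteq> 0" "\<forall>k\<in>{..<?d}. (\<Sum>i\<in>{..?d}. a i * F i (b k)) = 0"
    using linear_relation[of "{..<?d}" "{..?d}" "\<lambda>i k. F i (b k)"] by auto
  \<comment> \<open>For fixed coefficients the relation is linear in \<open>x\<close>, so it extends
    from the \<open>b k\<close> to their span.\<close>
  have rel: "(\<Sum>i\<le>?d. a i * F i x) = 0" if x: "x \<in> W j" for x
  proof -
    let ?K = "{x \<in> W j. (\<Sum>i\<le>?d. a i * F i x) = 0}"
    have "subspace ?K"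
    proof (rule subspaceI)
      show "0 \<in> ?K" by (simp add: subspace_0 equivariant_zero[OF F])
    next
      fix x y assume "x \<in> ?K" "y \<in> ?K"
      then show "x + y \<in> ?K"
        by (simp add: subspace_add equivariantD(1)[OF F] distrib_left sum.distrib)
    next
      fix c x assume "x \<in> ?K"
      then show "c *\<^sub>R x \<in> ?K"
        by (simp add: subspace_scale equivariantD(2)[OF F] flip: scaleR_sum_right)
    qed
    moreover have "b ` {..<?d} \<subseteq> ?K" using a(2) b(1) by auto
    ultimately have "span (b ` {..<?d}) \<subseteq> ?K" by (intro span_minimal)
    with x b(2) show ?thesis by auto
  qed
  obtain p where p: "p \<le> ?d" "a p \<noteq> 0" using a(1) by auto
  \<comment> \<open>The factor \<open>a p\<close> makes \<open>g p\<close> an average of squares, so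
    that averaging cannot annihilate it.\<close>
  define g where "g i = reynolds G (a p * a i)" for i
  have g_rel: "(\<Sum>i\<le>?d. g i * F i ?s) = 0"
  proof -
    have A: "(\<Sum>i\<le>?d. poly_act A (a p * a i) * F i ?s) = 0" if A: "A \<in> G" for A
    proof -
      \<comment> \<open>Applying \<open>A\<close> to the relation at this \<open>y\<close> gives a
        relation at \<open>?s\<close> again, with transformed coefficients; these relations can be
        averaged.\<close>
      define y where "y = poly_act (matrix_inv A) ?s"
      have y: "y \<in> W j" "poly_act A y = ?s"
        using A sW by (simp_all add: y_def W_act inv_closed act_inv)
      have "poly_act A (a p * (\<Sum>i\<le>?d. a i * F i y)) = (\<Sum>i\<le>?d. poly_act A (a p * a i) * F i ?s)"
        using y(2) by (simp add: poly_act_mult poly_act_sum sum_distrib_left mult.assoc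
            flip: equivariantD(3)[OF F A y(1)])
      then show ?thesis by (simp add: rel[OF y(1)])
    qed
    have "(\<Sum>i\<le>?d. g i * F i ?s)
        = (1 / real (card G)) *\<^sub>R (\<Sum>i\<le>?d. \<Sum>A\<in>G. poly_act A (a p * a i) * F i ?s)"
      by (simp add: g_def reynolds_def sum_distrib_right scaleR_sum_right)
    also have "\<dots> = 0" by (subst sum.swap) (simp add: A)
    finally show ?thesis .
  qed
  have "g p \<noteq> 0"
  proof
    assume "g p = 0"
    then have "(\<Sum>A\<in>G. (poly_act A (a p))\<^sup>2) = 0"
      using card_G by (simp add: g_def reynolds_def poly_act_mult power2_eq_square)
    from sum_squares_eq_0[OF finite_G this one_closed] p(2) show False by simp
  qed
  \<comment> \<open>Otherwise the \<open>s j i\<close> and \<open>J ?s\<close> are independent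
    modulo the ideal, and freeness forces \<open>g p = 0\<close>.\<close>
  have eigen: "\<exists>c. J ?s = c *\<^sub>R ?s"
  proof (rule ccontr)
    assume no: "\<nexists>c. J ?s = c *\<^sub>R ?s"
    have "\<forall>i<?d. \<exists>e. homog (int e) (s j i)"
      using s_homogeneous[OF j] by (simp add: homogeneous_iff_homog)
    then obtain e where e: "\<And>i. i < ?d \<Longrightarrow> homog (int (e i)) (s j i)" by metis
    have Fs: "F i ?s = (if i < ?d then s j i else J ?s)" for i
      using phi_s[OF j] by (simp add: F_def)
    have "g p = 0"
    proof (rule invariants_free[where T = "{..?d}" and h = "\<lambda>i. F i ?s"
          and dg = "\<lambda>i. if i < ?d then e i else e 0"])
      show "homog (int (if t < ?d then e t else e 0)) (F t ?s)" for t
        using e homog_orbit_span[OF e[OF d0] JW[OF sW]] by (simp add: Fs)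
    next
      fix c t assume I: "(\<Sum>i\<in>{..?d}. c i *\<^sub>R F i ?s) \<in> psi_ideal \<psi>" and t: "t \<in> {..?d}"
      \<comment> \<open>\<open>J ?s\<close> lies in the first copy, so its term is merged with the
        one for \<open>i = 0\<close> before directness is applied. It also shares the degree
        \<open>e 0\<close>.\<close>
      define x where "x i = c i *\<^sub>R s j i + (if i = 0 then c ?d *\<^sub>R J ?s else 0)" for i
      have "(\<Sum>i<?d. x i) = (\<Sum>i\<in>{..?d}. c i *\<^sub>R F i ?s)"
        using d0 by (simp add: x_def sum.distrib Fs flip: lessThan_Suc_atMost)
      with I have "(\<Sum>i<?d. x i) \<in> psi_ideal \<psi>" by simp
      moreover have "x i \<in> orbit_span G (s j i)" for i
        using JW[OF sW] self_in_orbit_span[of "s j i"]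
        by (auto simp: x_def intro!: subspace_add subspace_scale)
      ultimately have x0: "x i = 0" if "i < ?d" for i
        using single_copy_independent[OF j, of x i] that by blast
      from x0[OF d0] have s0: "c 0 *\<^sub>R ?s + c ?d *\<^sub>R J ?s = 0" by (simp add: x_def)
      have cd: "c ?d = 0"
      proof (rule ccontr)
        assume "c ?d \<noteq> 0"
        moreover have "c ?d *\<^sub>R J ?s = (- c 0) *\<^sub>R ?s" using s0 by (simp add: eq_neg_iff_add_eq_0 add.commute)
        ultimately have "J ?s = (- c 0 / c ?d) *\<^sub>R ?s"
          by (metis (no_types, lifting) divide_inverse_commute scaleR_one scaleR_scaleR left_inverse)
        with no show False by blast
      qed
      have "c i = 0" if i: "i < ?d" for i
        using x0[OF i] cd s_nonzero[OF j i] by (simp add: x_def split: if_splits)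
      with cd t show "c t = 0" by (cases "t = ?d") auto
    qed (use g_rel p(1) in \<open>auto simp: g_def reynolds_invariant\<close>)
    with \<open>g p \<noteq> 0\<close> show False by contradiction
  qed
  then obtain c where c: "J ?s = c *\<^sub>R ?s" by blast
  \<comment> \<open>The eigenspace is a subspace containing the orbit of \<open>?s\<close>, and this
    orbit spans \<open>W j\<close>.\<close>
  let ?K = "{x \<in> W j. J x = c *\<^sub>R x}"
  have "subspace ?K"
  proof (rule subspaceI)
    show "0 \<in> ?K" by (simp add: subspace_0 equivariant_zero[OF J])
  next
    fix x y assume "x \<in> ?K" "y \<in> ?K"
    then show "x + y \<in> ?K" by (simp add: subspace_add equivariantD(1)[OF J] scaleR_add_right)
  next
    fix a x assume "x \<in> ?K"
    then show "a *\<^sub>R x \<in> ?K" by (simp add: subspace_scale equivariantD(2)[OF J])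
  qed
  moreover have "(\<lambda>A. poly_act A ?s) ` G \<subseteq> ?K"
    using sW c by (auto simp: W_act equivariantD(3)[OF J] poly_act_scaleR)
  ultimately have "W j \<subseteq> ?K" unfolding orbit_span_def[of G ?s] by (intro span_minimal)
  then show ?thesis by blast
qed

lemma invariant_form_scalar:
  assumes j: "j < l" and B: "invariant_form G (W j) (W j) B"
  shows "\<exists>c. \<forall>x\<in>W j. \<forall>y\<in>W j. B x y = c * ip x y"
proof -
  obtain T where T: "equivariant G (W j) T" "\<And>x. x \<in> W j \<Longrightarrow> T x \<in> W j"
    "\<And>x y. x \<in> W j \<Longrightarrow> y \<in> W j \<Longrightarrow> ip (T x) y = B x y"
    using ip_representation[OF B orbit_span_stable] by blast
  obtain c where c: "\<And>x. x \<in> W j \<Longrightarrow> T x = c *\<^sub>R x" using endomorphism_scalar[OF j T(1,2)] by blast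
  have "B x y = c * ip x y" if "x \<in> W j" "y \<in> W j" for x y
    using T(3)[OF that] c[OF that(1)] by (simp add: ip_sym[of _ y] linear_scale[OF linear_ip])
  then show ?thesis by blast
qed

lemma invariant_form_zero:
  assumes j: "j < l" and k: "k < l" and jk: "j \<noteq> k"
    and B: "invariant_form G (W j) (W k) B" and x: "x \<in> W j" and y: "y \<in> W k"
  shows "B x y = 0"
proof -
  obtain T where T: "equivariant G (W j) T" "\<And>x. x \<in> W j \<Longrightarrow> T x \<in> W k"
    "\<And>x y. x \<in> W j \<Longrightarrow> y \<in> W k \<Longrightarrow> ip (T x) y = B x y"
    using ip_representation[OF B orbit_span_stable] by blast
  have "T x = 0"
    using schur[OF irred0[OF j] irred0[OF k] T(1,2)] non_iso[OF j k jk T(1)] x by blast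
  with T(3)[OF x y] show ?thesis by (simp add: ip_def coef_dot_def)
qed

section \<open>Averaged products and the expansion of squares\<close>

lemma reynolds_form:
  assumes "j < l" "u < \<eta> j" "k < l" "v < \<eta> k"
  shows "invariant_form G (W j) (W k) (\<lambda>x y. coef (reynolds G (\<phi> j u x * \<phi> k v y)) m)"
proof -
  note E1 = equivariantD[OF phi_equi[OF assms(1,2)]]
    and E2 = equivariantD[OF phi_equi[OF assms(3,4)]]
  have "reynolds G (\<phi> j u (poly_act A x) * \<phi> k v (poly_act A y)) = reynolds G (\<phi> j u x * \<phi> k v y)"
    if "A \<in> G" "x \<in> W j" "y \<in> W k" for A x y
    using that by (simp add: E1 E2 reynolds_act flip: poly_act_mult)
  then show ?thesis
    by (simp add: invariant_form_def E1(1,2) E2(1,2) distrib_left distrib_right reynolds_add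
        reynolds_scaleR lookup_add)
qed

lemma reynolds_same_type:
  assumes j: "j < l" and u: "u < \<eta> j" and v: "v < \<eta> j" and x: "x \<in> W j" and y: "y \<in> W j"
  shows "reynolds G (\<phi> j u x * \<phi> j v y)
    = (ip x y / ip (s j 0) (s j 0)) *\<^sub>R reynolds G (s j u * s j v)"
proof (rule poly_mapping_eqI)
  fix m
  obtain c where c: "\<And>x y. x \<in> W j \<Longrightarrow> y \<in> W j \<Longrightarrow>
      coef (reynolds G (\<phi> j u x * \<phi> j v y)) m = c * ip x y"
    using invariant_form_scalar[OF j reynolds_form[OF j u j v]] by blast
  \<comment> \<open>The constant \<open>c\<close> depends on the monomial \<open>m\<close>; the
    ratio of inner products that replaces it does not.\<close>
  have "coef (reynolds G (s j u * s j v)) m = c * ip (s j 0) (s j 0)"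
    using c[OF self_in_orbit_span self_in_orbit_span] phi_s[OF j] u v by simp
  moreover have "ip (s j 0) (s j 0) > 0"
    using s_nonzero[OF j eta_pos[OF j]] by (rule ip_pos)
  ultimately show "coef (reynolds G (\<phi> j u x * \<phi> j v y)) m
      = coef ((ip x y / ip (s j 0) (s j 0)) *\<^sub>R reynolds G (s j u * s j v)) m"
    by (simp add: c[OF x y])
qed

lemma reynolds_distinct_types:
  assumes "j < l" "k < l" "j \<noteq> k" "u < \<eta> j" "v < \<eta> k" "x \<in> W j" "y \<in> W k"
  shows "reynolds G (\<phi> j u x * \<phi> k v y) = 0"
  by (rule poly_mapping_eqI)
    (use invariant_form_zero[OF assms(1-3) reynolds_form[OF assms(1,4,2,5)] assms(6,7)] in simp)

definition onb :: "nat \<Rightarrow> 'n rpoly set" where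
  "onb j = (SOME E. finite E \<and> span E = W j \<and>
     (\<forall>e\<in>E. \<forall>e'\<in>E. ip e e' = (if e = e' then 1 else 0)))"

lemma onb_props:
  shows finite_onb: "finite (onb j)" and span_onb: "span (onb j) = W j"
    and ortho_onb: "\<And>e e'. e \<in> onb j \<Longrightarrow> e' \<in> onb j \<Longrightarrow> ip e e' = (if e = e' then 1 else 0)"
proof -
  have "\<exists>E. finite E \<and> span E = W j \<and> (\<forall>e\<in>E. \<forall>e'\<in>E. ip e e' = (if e = e' then 1 else 0))"
    by (rule orthonormal_basis_orbit_span[of "s j 0"]) blast
  from someI_ex[OF this]
  show "finite (onb j)" "span (onb j) = W j"
    "\<And>e e'. e \<in> onb j \<Longrightarrow> e' \<in> onb j \<Longrightarrow> ip e e' = (if e = e' then 1 else 0)"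
    by (auto simp: onb_def[symmetric])
qed

lemma onb_subset: "e \<in> onb j \<Longrightarrow> e \<in> W j"
  using span_onb span_base by blast

lemma phi_expansion:
  assumes j: "j < l" "i < \<eta> j" and z: "z \<in> orbit_span G (s j i)"
  shows "\<exists>c. z = (\<Sum>e\<in>onb j. c e *\<^sub>R \<phi> j i e)"
proof -
  obtain y where y: "y \<in> W j" "z = \<phi> j i y" using z phi_image[OF j] by blast
  have "y = (\<Sum>e\<in>onb j. ip e y *\<^sub>R e)"
    using y(1) by (intro orthonormal_expansion linear_ip finite_onb ortho_onb) (auto simp: span_onb)
  then have "z = \<phi> j i (\<Sum>e\<in>onb j. ip e y *\<^sub>R e)" using y(2) by simp
  also have "\<dots> = (\<Sum>e\<in>onb j. ip e y *\<^sub>R \<phi> j i e)"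
    by (rule equivariant_sum[OF phi_equi[OF j] subspace_orbit_span onb_subset])
  finally show ?thesis by (rule exI[of _ "\<lambda>e. ip e y"])
qed

lemma module_generation:
  obtains c where "\<And>j i e. c j i e \<in> invariants G"
    "f = (\<Sum>j<l. \<Sum>i<\<eta> j. \<Sum>e\<in>onb j. c j i e * \<phi> j i e)"
proof -
  define lin where "lin c = (\<Sum>j<l. \<Sum>i<\<eta> j. \<Sum>e\<in>onb j. c j i e * \<phi> j i e)"
    for c :: "nat \<Rightarrow> nat \<Rightarrow> 'n rpoly \<Rightarrow> 'n rpoly"
  define M where "M = {lin c | c. \<forall>j i e. c j i e \<in> invariants G}"
  define S where "S = {\<Sum>p\<in>index_set l \<eta>. x p | x. \<forall>j<l. \<forall>i<\<eta> j. x (j, i) \<in> orbit_span G (s j i)}"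
  have "f \<in> M"
  proof (rule graded_nakayama[where S = S])
    show "\<exists>x\<in>S. f - x \<in> psi_ideal \<psi>" for f using spanning[of f] by (auto simp: S_def)
  next
    fix z d assume "z \<in> S"
    then obtain x where x: "\<And>j i. j < l \<Longrightarrow> i < \<eta> j \<Longrightarrow> x (j, i) \<in> orbit_span G (s j i)"
      "z = (\<Sum>p\<in>index_set l \<eta>. x p)" by (auto simp: S_def)
    have "\<exists>c. hcomp d (x (j, i)) = (\<Sum>e\<in>onb j. c e *\<^sub>R \<phi> j i e)" if j: "j < l" "i < \<eta> j" for j i
    proof (rule phi_expansion[OF j])
      \<comment> \<open>Each copy lives in a single degree, so a homogeneous component of a summand
        is the summand itself or zero and stays in the copy.\<close>
      obtain e where "homog (int e) (s j i)"
        using s_homogeneous[OF j] by (auto simp: homogeneous_iff_homog)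
      from hcomp_homog[OF homog_orbit_span[OF this x(1)[OF j]]]
      show "hcomp d (x (j, i)) \<in> orbit_span G (s j i)"
        using x(1)[OF j] by (simp add: subspace_0)
    qed
    then have "\<forall>j i. \<exists>c. j < l \<longrightarrow> i < \<eta> j \<longrightarrow> hcomp d (x (j, i)) = (\<Sum>e\<in>onb j. c e *\<^sub>R \<phi> j i e)"
      by blast
    then obtain c where c: "\<And>j i. j < l \<Longrightarrow> i < \<eta> j \<Longrightarrow>
        hcomp d (x (j, i)) = (\<Sum>e\<in>onb j. c j i e *\<^sub>R \<phi> j i e)" by metis
    have "hcomp d z = lin (\<lambda>j i e. c j i e *\<^sub>R 1)"
      by (simp add: x(2) sum_index_set hcomp_sum c lin_def)
    then show "hcomp d z \<in> M" unfolding M_def using invariants_scaleR[OF invariants_one] by blast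
  next
    have "0 = lin (\<lambda>j i e. 0)" by (simp add: lin_def)
    then show "0 \<in> M" unfolding M_def using invariants_zero by blast
  next
    fix x y assume "x \<in> M" "y \<in> M"
    then obtain c c' where c: "\<forall>j i e. c j i e \<in> invariants G" "\<forall>j i e. c' j i e \<in> invariants G"
      "x = lin c" "y = lin c'" by (auto simp: M_def)
    have "x + y = lin (\<lambda>j i e. c j i e + c' j i e)"
      by (simp add: c lin_def distrib_right sum.distrib)
    moreover have "\<forall>j i e. c j i e + c' j i e \<in> invariants G" using c by (simp add: invariants_add)
    ultimately show "x + y \<in> M" unfolding M_def by blast
  next
    fix g x assume g: "g \<in> invariants G" and "x \<in> M"
    then obtain c where c: "\<forall>j i e. c j i e \<in> invariants G" "x = lin c" by (auto simp: M_def)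
    have "g * x = lin (\<lambda>j i e. g * c j i e)"
      by (simp add: c lin_def sum_distrib_left mult.assoc)
    moreover have "\<forall>j i e. g * c j i e \<in> invariants G" using c g by (simp add: invariants_mult)
    ultimately show "g * x \<in> M" unfolding M_def by blast
  qed
  then show thesis using that by (auto simp: M_def lin_def)
qed

text \<open>Cross terms between distinct types vanish, and so do those between distinct vectors of
  \<open>onb j\<close>. What remains is one rank-one Gram matrix for each \<open>e\<close>.\<close>

lemma reynolds_square:
  obtains c where "\<And>j u e. c j u e \<in> invariants G"
    "reynolds G (q\<^sup>2) = (\<Sum>j<l. \<Sum>e\<in>onb j. \<Sum>u<\<eta> j. \<Sum>v<\<eta> j.
      c j u e * c j v e * reynolds G (s j u * s j v))"
proof -
  obtain d where d: "\<And>j i e. d j i e \<in> invariants G"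
    and q: "q = (\<Sum>j<l. \<Sum>i<\<eta> j. \<Sum>e\<in>onb j. d j i e * \<phi> j i e)"
    by (rule module_generation[where f = q]) blast
  define Q where "Q j = (\<Sum>i<\<eta> j. \<Sum>e\<in>onb j. d j i e * \<phi> j i e)" for j
  define n where "n j = ip (s j 0) (s j 0)" for j
  \<comment> \<open>The positive factor \<open>1 / n j\<close> from
    \<open>reynolds_same_type\<close> is shared evenly by the two coefficients.\<close>
  define c where "c j i e = (1 / sqrt (n j)) *\<^sub>R d j i e" for j i e
  have QQ: "reynolds G (Q j * Q k) = (\<Sum>u<\<eta> j. \<Sum>v<\<eta> k. \<Sum>e\<in>onb j. \<Sum>e'\<in>onb k.
      d j u e * d k v e' * reynolds G (\<phi> j u e * \<phi> k v e'))" for j k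
  proof -
    have "reynolds G ((d j u e * \<phi> j u e) * (d k v e' * \<phi> k v e'))
        = d j u e * d k v e' * reynolds G (\<phi> j u e * \<phi> k v e')" for u v e e'
      using reynolds_mult[OF invariants_mult[OF d d], of j u e k v e' "\<phi> j u e * \<phi> k v e'"]
      by (simp add: ac_simps)
    then show ?thesis by (simp add: Q_def sum_product reynolds_sum)
  qed
  have off: "reynolds G (Q j * Q k) = 0" if "j < l" "k < l" "j \<noteq> k" for j k
    unfolding QQ using that by (intro sum.neutral ballI) (simp add: reynolds_distinct_types onb_subset)
  have diag: "reynolds G (Q j * Q j) = (\<Sum>e\<in>onb j. \<Sum>u<\<eta> j. \<Sum>v<\<eta> j.
      c j u e * c j v e * reynolds G (s j u * s j v))" if j: "j < l" for j
  proof -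
    have n: "n j > 0" unfolding n_def using s_nonzero[OF j eta_pos[OF j]] by (rule ip_pos)
    have term_eq: "(\<Sum>e'\<in>onb j. d j u e * d j v e' * reynolds G (\<phi> j u e * \<phi> j v e'))
        = c j u e * c j v e * reynolds G (s j u * s j v)"
      if uv: "u < \<eta> j" "v < \<eta> j" and e: "e \<in> onb j" for u v e
    proof -
      have "(\<Sum>e'\<in>onb j. d j u e * d j v e' * reynolds G (\<phi> j u e * \<phi> j v e'))
          = (\<Sum>e'\<in>onb j. if e = e' then (1 / n j) *\<^sub>R (d j u e * d j v e' * reynolds G (s j u * s j v)) else 0)"
      proof (rule sum.cong)
        fix e' assume e': "e' \<in> onb j"
        show "d j u e * d j v e' * reynolds G (\<phi> j u e * \<phi> j v e')
          = (if e = e' then (1 / n j) *\<^sub>R (d j u e * d j v e' * reynolds G (s j u * s j v)) else 0)"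
          using ortho_onb[OF e e']
          unfolding reynolds_same_type[OF j uv onb_subset[OF e] onb_subset[OF e']] n_def
          by simp
      qed simp
      also have "\<dots> = (1 / n j) *\<^sub>R (d j u e * d j v e * reynolds G (s j u * s j v))"
        using finite_onb e by simp
      also have "\<dots> = c j u e * c j v e * reynolds G (s j u * s j v)"
        using n by (simp add: c_def)
      finally show ?thesis .
    qed
    have "reynolds G (Q j * Q j) = (\<Sum>u<\<eta> j. \<Sum>v<\<eta> j. \<Sum>e\<in>onb j.
        c j u e * c j v e * reynolds G (s j u * s j v))"
      unfolding QQ by (intro sum.cong refl term_eq) auto
    also have "\<dots> = (\<Sum>u<\<eta> j. \<Sum>e\<in>onb j. \<Sum>v<\<eta> j. c j u e * c j v e * reynolds G (s j u * s j v))"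
      by (rule sum.cong[OF refl], rule sum.swap)
    also have "\<dots> = (\<Sum>e\<in>onb j. \<Sum>u<\<eta> j. \<Sum>v<\<eta> j. c j u e * c j v e * reynolds G (s j u * s j v))"
      by (rule sum.swap)
    finally show ?thesis .
  qed
  have "q\<^sup>2 = (\<Sum>j<l. \<Sum>k<l. Q j * Q k)" by (simp add: q Q_def power2_eq_square sum_product)
  then have "reynolds G (q\<^sup>2) = (\<Sum>j<l. \<Sum>k<l. reynolds G (Q j * Q k))"
    by (simp add: reynolds_sum)
  also have "\<dots> = (\<Sum>j<l. \<Sum>k<l. if j = k then reynolds G (Q j * Q j) else 0)"
    by (intro sum.cong refl) (use off in auto)
  also have "\<dots> = (\<Sum>j<l. reynolds G (Q j * Q j))" by simp
  also have "\<dots> = (\<Sum>j<l. \<Sum>e\<in>onb j. \<Sum>u<\<eta> j. \<Sum>v<\<eta> j.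
      c j u e * c j v e * reynolds G (s j u * s j v))"
    by (rule sum.cong) (simp_all add: diag)
  finally show thesis using that[of c] d by (simp add: c_def invariants_scaleR)
qed

end

section \<open>From modules with carriers to subspaces of polynomials\<close>

lemma orbit_module_simps [simp]:
  "carrier (orbit_module G f) = orbit_span G f"
  "add (orbit_module G f) = (+)" "zero (orbit_module G f) = 0"
  "smult (orbit_module G f) = scaleR" "act (orbit_module G f) = poly_act"
  by (simp_all add: orbit_module_def poly_gmodule_def orbit_span_def)

lemma gmodule_iso_orbit_module:
  "T \<in> gmodule_iso G (orbit_module G f) (orbit_module G g) \<longleftrightarrow>
     equivariant G (orbit_span G f) T \<and> bij_betw T (orbit_span G f) (orbit_span G g)"
  by (auto simp: gmodule_iso_def equivariant_def)

lemma (in finite_matrix_group) irreducible_orbit_module: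
  assumes "irreducible_gmodule G (orbit_module G f)"
  shows "irreducible_subspace G (orbit_span G f)"
  unfolding irreducible_subspace_def
proof (intro conjI allI impI)
  show "stable_subspace G (orbit_span G f)" by (rule orbit_span_stable)
  show "orbit_span G f \<noteq> {0}" using assms by (simp add: irreducible_gmodule_def)
next
  fix N assume N: "stable_subspace G N \<and> N \<subseteq> orbit_span G f"
  then have sub: "subspace N" by (simp add: stable_subspace_def)
  \<comment> \<open>\<open>submodule\<close> asks for closure under the inverse of the additive
    monoid, a definite description that has to be identified with negation.\<close>
  have inv: "inv\<^bsub>add_monoid (orbit_module G f)\<^esub> x = - x" if "x \<in> N" for x
    unfolding m_inv_def
  proof (rule the_equality)
    have "x \<in> orbit_span G f" using N that by auto
    then show "- x \<in> carrier (add_monoid (orbit_module G f)) \<and>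
        x \<otimes>\<^bsub>add_monoid (orbit_module G f)\<^esub> - x = \<one>\<^bsub>add_monoid (orbit_module G f)\<^esub> \<and>
        - x \<otimes>\<^bsub>add_monoid (orbit_module G f)\<^esub> x = \<one>\<^bsub>add_monoid (orbit_module G f)\<^esub>"
      by (simp add: subspace_neg)
  qed (simp add: eq_neg_iff_add_eq_0)
  have "submodule N real_scalars (orbit_module G f)"
  proof (intro submodule.intro subgroup.intro submodule_axioms.intro)
    show "inv\<^bsub>add_monoid (orbit_module G f)\<^esub> x \<in> N" if "x \<in> N" for x
      using inv[OF that] subspace_neg[OF sub that] by (simp only:)
  qed (use N sub in \<open>auto simp: subspace_add subspace_scale subspace_0\<close>)
  with N have "gsubmodule G N (orbit_module G f)"
    by (simp add: gsubmodule_def stable_subspace_def)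
  with assms show "N = {0} \<or> N = orbit_span G f"
    by (auto simp: irreducible_gmodule_def)
qed

lemma gmodule_iso_compose:
  assumes S: "S \<in> gmodule_iso G M N" and T: "T \<in> gmodule_iso G N P"
  shows "T \<circ> S \<in> gmodule_iso G M P"
proof -
  have "S x \<in> carrier N" if "x \<in> carrier M" for x
    using S that by (auto simp: gmodule_iso_def bij_betw_def)
  then show ?thesis
    using assms unfolding gmodule_iso_def by (auto intro: bij_betw_trans)
qed

lemma gmodule_iso_inverse:
  assumes T: "T \<in> gmodule_iso G M N"
    and add: "\<And>x y. x \<in> carrier M \<Longrightarrow> y \<in> carrier M \<Longrightarrow> x \<oplus>\<^bsub>M\<^esub> y \<in> carrier M"
    and smult: "\<And>c x. x \<in> carrier M \<Longrightarrow> c \<odot>\<^bsub>M\<^esub> x \<in> carrier M"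
    and act: "\<And>A x. A \<in> G \<Longrightarrow> x \<in> carrier M \<Longrightarrow> act M A x \<in> carrier M"
  shows "inv_into (carrier M) T \<in> gmodule_iso G N M"
proof -
  let ?S = "inv_into (carrier M) T"
  have bij: "bij_betw T (carrier M) (carrier N)" using T by (simp add: gmodule_iso_def)
  have SM: "?S x \<in> carrier M" and TS: "T (?S x) = x" if "x \<in> carrier N" for x
    using bij that by (auto simp: bij_betw_def inv_into_into f_inv_into_f)
  have ST: "?S (T x) = x" if "x \<in> carrier M" for x
    using bij that by (simp add: bij_betw_def)
  have "?S (x \<oplus>\<^bsub>N\<^esub> y) = ?S x \<oplus>\<^bsub>M\<^esub> ?S y" if "x \<in> carrier N" "y \<in> carrier N" for x y
  proof -
    have "T (?S x \<oplus>\<^bsub>M\<^esub> ?S y) = x \<oplus>\<^bsub>N\<^esub> y"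
      using T SM that TS by (simp add: gmodule_iso_def)
    then show ?thesis using ST[OF add] SM that by metis
  qed
  moreover have "?S (c \<odot>\<^bsub>N\<^esub> x) = c \<odot>\<^bsub>M\<^esub> ?S x" if "x \<in> carrier N" for c x
  proof -
    have "T (c \<odot>\<^bsub>M\<^esub> ?S x) = c \<odot>\<^bsub>N\<^esub> x" using T SM that TS by (simp add: gmodule_iso_def)
    then show ?thesis using ST[OF smult] SM that by metis
  qed
  moreover have "?S (act N A x) = act M A (?S x)" if "A \<in> G" "x \<in> carrier N" for A x
  proof -
    have "T (act M A (?S x)) = act N A x" using T SM that TS by (simp add: gmodule_iso_def)
    then show ?thesis using ST[OF act] SM that by metis
  qed
  ultimately show ?thesis
    using bij_betw_inv_into[OF bij] by (simp add: gmodule_iso_def)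
qed

lemma (in finite_matrix_group) orbit_module_iso_inverse:
  assumes "T \<in> gmodule_iso G (orbit_module G f) N"
  shows "inv_into (orbit_span G f) T \<in> gmodule_iso G N (orbit_module G f)"
proof -
  have "inv_into (carrier (orbit_module G f)) T \<in> gmodule_iso G N (orbit_module G f)"
    by (rule gmodule_iso_inverse[OF assms])
      (use orbit_span_stable[of f] in \<open>simp_all add: stable_subspace_def subspace_add subspace_scale\<close>)
  then show ?thesis by simp
qed

text \<open>A basis of \<open>M\<close> is pulled back along the isomorphism; the bound on the
  number of spanning vectors is what the counting argument consumes.\<close>

lemma (in finite_matrix_group) orbit_span_dimension:
  assumes iso: "gmodule_isomorphic G (orbit_module G f) M"
    and M: "Module.module real_scalars M" and dim: "has_dimension M d"
  shows "\<exists>b. b ` {..<d} \<subseteq> orbit_span G f \<and> orbit_span G f \<subseteq> span (b ` {..<d})"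
proof -
  interpret M: Module.module real_scalars M by (rule M)
  obtain T where T: "T \<in> gmodule_iso G (orbit_module G f) M"
    using iso by (auto simp: gmodule_isomorphic_def)
  obtain b where b: "b \<in> {..<d} \<rightarrow> carrier M"
    "bij_betw (\<lambda>c. \<Oplus>\<^bsub>M\<^esub>k\<in>{..<d}. c k \<odot>\<^bsub>M\<^esub> b k) ({..<d} \<rightarrow>\<^sub>E (UNIV :: real set)) (carrier M)"
    using dim by (auto simp: has_dimension_def)
  have bij: "bij_betw T (orbit_span G f) (carrier M)" using T by (simp add: gmodule_iso_def)
  define b' where "b' k = inv_into (orbit_span G f) T (b k)" for k
  have b': "b' k \<in> orbit_span G f" "T (b' k) = b k" if "k < d" for k
    using bij b(1) that by (auto simp: b'_def bij_betw_def inv_into_into f_inv_into_f Pi_iff)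
  have comb: "(\<Sum>k\<in>K. c k *\<^sub>R b' k) \<in> orbit_span G f" if "K \<subseteq> {..<d}" for c K
    using that b' by (auto intro!: subspace_sum subspace_scale)
  have T_comb: "T (\<Sum>k\<in>K. c k *\<^sub>R b' k) = (\<Oplus>\<^bsub>M\<^esub>k\<in>K. c k \<odot>\<^bsub>M\<^esub> b k)"
    if "finite K" "K \<subseteq> {..<d}" for c K
    using that
  proof (induction K rule: finite_induct)
    case empty
    \<comment> \<open>\<open>gmodule_iso\<close> does not mention zero, so \<open>T 0\<close> is
      computed as a multiple by the scalar 0.\<close>
    have z: "0 \<in> orbit_span G f" by (simp add: subspace_0)
    then have "T (0 *\<^sub>R 0) = 0 \<odot>\<^bsub>M\<^esub> T 0" using T unfolding gmodule_iso_def by fastforce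
    moreover have "T 0 \<in> carrier M" using z bij by (auto simp: bij_betw_def)
    then have "\<zero>\<^bsub>real_scalars\<^esub> \<odot>\<^bsub>M\<^esub> T 0 = \<zero>\<^bsub>M\<^esub>" by (rule M.smult_l_null)
    ultimately show ?case by (simp add: real_scalars_def)
  next
    case (insert k K)
    have cM: "c k \<odot>\<^bsub>M\<^esub> b k \<in> carrier M" if "k < d" for k
      using b(1) that by (intro M.smult_closed) (auto simp: real_scalars_def)
    have k: "k < d" "K \<subseteq> {..<d}" using insert.prems by auto
    have "T (c k *\<^sub>R b' k + (\<Sum>k\<in>K. c k *\<^sub>R b' k)) = c k \<odot>\<^bsub>M\<^esub> b k \<oplus>\<^bsub>M\<^esub> T (\<Sum>k\<in>K. c k *\<^sub>R b' k)"
      using T b'[OF k(1)] comb[OF k(2), of c] by (simp add: gmodule_iso_def subspace_scale)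
    moreover have "(\<Oplus>\<^bsub>M\<^esub>k\<in>insert k K. c k \<odot>\<^bsub>M\<^esub> b k) = c k \<odot>\<^bsub>M\<^esub> b k \<oplus>\<^bsub>M\<^esub> (\<Oplus>\<^bsub>M\<^esub>k\<in>K. c k \<odot>\<^bsub>M\<^esub> b k)"
      using insert.hyps cM k by (intro M.finsum_insert) auto
    ultimately show ?case using insert k by simp
  qed
  have "x \<in> span (b' ` {..<d})" if x: "x \<in> orbit_span G f" for x
  proof -
    have "T x \<in> carrier M" using x bij by (auto simp: bij_betw_def)
    then obtain c where "T x = (\<Oplus>\<^bsub>M\<^esub>k\<in>{..<d}. c k \<odot>\<^bsub>M\<^esub> b k)"
      using b(2) by (auto simp: bij_betw_def)
    then have "T x = T (\<Sum>k<d. c k *\<^sub>R b' k)" using T_comb[of "{..<d}" c] by simp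
    then have "x = (\<Sum>k<d. c k *\<^sub>R b' k)"
      using bij x comb[OF subset_refl, of c] by (auto simp: bij_betw_def dest: inj_onD)
    moreover have "(\<Sum>k<d. c k *\<^sub>R b' k) \<in> span (b' ` {..<d})"
      by (rule span_sum, rule span_scale, rule span_base, rule imageI)
    ultimately show ?thesis by simp
  qed
  moreover have "b' ` {..<d} \<subseteq> orbit_span G f" using b' by auto
  ultimately show ?thesis by blast
qed

section \<open>The coinvariant algebra as a quotient\<close>

lemma poly_ring_simps [simp]:
  "carrier poly_ring = UNIV" "mult poly_ring = (*)" "one poly_ring = 1"
  "zero poly_ring = 0" "add poly_ring = (+)"
  by (simp_all add: poly_ring_def)

lemma cring_poly_ring: "cring (poly_ring :: 'n::finite rpoly ring)"
proof (rule cringI)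
  show "abelian_group (poly_ring :: 'n rpoly ring)"
    by (rule abelian_groupI) (auto intro: exI[of _ "- _"] simp: add.assoc add.commute)
  show "comm_monoid (poly_ring :: 'n rpoly ring)"
    by (rule comm_monoidI) (auto simp: mult.assoc mult.commute)
qed (simp add: distrib_right)

text \<open>Replaces the intersection of ideals behind \<open>genideal\<close> by explicit
  combinations of the generators, on which degrees can be compared.\<close>

lemma coinvariant_ideal_eq: "coinvariant_ideal \<psi> = psi_ideal \<psi>"
  for \<psi> :: "'n::finite \<Rightarrow> 'n rpoly"
proof
  interpret R: cring "poly_ring :: 'n rpoly ring" by (rule cring_poly_ring)
  have "inv\<^bsub>add_monoid poly_ring\<^esub> f = - f" for f :: "'n rpoly"
    using R.add.inv_equality[of "- f" f] by (simp add: a_inv_def)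
  then have "subgroup (psi_ideal \<psi>) (add_monoid poly_ring)"
    by (intro subgroup.intro) (auto simp: psi_ideal_add psi_ideal_minus)
  then have "ideal (psi_ideal \<psi>) poly_ring"
    using psi_ideal_mult[of _ \<psi>] by (intro idealI R.ring_axioms) (simp_all add: mult.commute)
  then show "coinvariant_ideal \<psi> \<subseteq> psi_ideal \<psi>"
    unfolding coinvariant_ideal_def
    by (rule R.genideal_minimal) (auto simp: psi_ideal_generator)
  have "ideal (coinvariant_ideal \<psi>) poly_ring"
    unfolding coinvariant_ideal_def by (rule R.genideal_ideal) simp
  then interpret I: ideal "coinvariant_ideal \<psi>" poly_ring .
  have gen: "\<psi> i \<in> coinvariant_ideal \<psi>" for i
    using R.genideal_self[of "range \<psi>"] by (auto simp: coinvariant_ideal_def)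
  have "(\<Sum>i\<in>K. a i * \<psi> i) \<in> coinvariant_ideal \<psi>" for a and K :: "'n set"
  proof (induction K rule: infinite_finite_induct)
    case (insert i K)
    have "a i * \<psi> i \<in> coinvariant_ideal \<psi>" using I.I_l_closed[OF gen] by simp
    with insert I.a_closed show ?case by simp
  qed (use I.zero_closed in simp_all)
  then show "psi_ideal \<psi> \<subseteq> coinvariant_ideal \<psi>" by (auto simp: psi_ideal_def)
qed

lemma coinvariant_class_eq_iff:
  fixes \<psi> :: "'n::finite \<Rightarrow> 'n rpoly"
  shows "coinvariant_class \<psi> f = coinvariant_class \<psi> g \<longleftrightarrow> f - g \<in> psi_ideal \<psi>"
proof -
  have cls: "coinvariant_class \<psi> f = {h. h - f \<in> psi_ideal \<psi>}" for f
    unfolding coinvariant_class_def coinvariant_ideal_eq a_r_coset_def'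
    by (auto simp: algebra_simps intro: rev_bexI[of "_ - f"])
  show ?thesis
  proof
    assume "coinvariant_class \<psi> f = coinvariant_class \<psi> g"
    then show "f - g \<in> psi_ideal \<psi>" unfolding cls using psi_ideal_zero by force
  next
    assume fg: "f - g \<in> psi_ideal \<psi>"
    have "h - f \<in> psi_ideal \<psi> \<longleftrightarrow> h - g \<in> psi_ideal \<psi>" for h
      using psi_ideal_add[OF _ fg, of "h - f"] psi_ideal_diff[OF _ fg, of "h - g"] by auto
    then show "coinvariant_class \<psi> f = coinvariant_class \<psi> g" unfolding cls by simp
  qed
qed

lemma carrier_coinvariant_algebra:
  "carrier (coinvariant_algebra \<psi>) = range (coinvariant_class \<psi>)"
  by (auto simp: coinvariant_algebra_def Let_def FactRing_def A_RCOSETS_def' coinvariant_class_def)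

text \<open>Directness modulo the ideal and spanning are the injectivity and surjectivity of the
  class map on the sum of the orbit modules.\<close>

lemma adapted_basis_of_symmetry_adapted:
  fixes G :: "(real^'n^'n) set" and \<theta> :: "nat \<Rightarrow> (real^'n^'n, 'w) gmodule"
  assumes refl: "finite_reflection_group G"
    and fund: "fundamental_invariants G \<psi>"
    and const: "irreducible_constituents G (coinvariant_algebra \<psi>) l \<theta> \<eta>"
    and dim: "\<And>j. j < l \<Longrightarrow> has_dimension (\<theta> j) (\<eta> j)"
    and basis: "symmetry_adapted_basis G \<psi> l \<theta> \<eta> s"
  shows "\<exists>\<phi>. adapted_basis G \<psi> l \<eta> s \<phi>"
proof -
  interpret finite_matrix_group G
    using refl by (intro finite_matrix_group_GL) (auto simp: finite_reflection_group_def)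
  interpret reflection_invariants G \<psi>
    using refl fund by unfold_locales (auto simp: finite_reflection_group_def)
  let ?I = "index_set l \<eta>"
  have s: "homogeneous (s j i)" "irreducible_gmodule G (orbit_module G (s j i))"
    "gmodule_isomorphic G (orbit_module G (s j i)) (\<theta> j)"
    "\<exists>\<phi> \<in> gmodule_iso G (orbit_module G (s j 0)) (orbit_module G (s j i)). \<phi> (s j 0) = s j i"
    if "j < l" "i < \<eta> j" for j i
    using basis that unfolding symmetry_adapted_basis_def by (auto simp: index_set_def)
  have eta: "0 < \<eta> j" if "j < l" for j
    using const that by (auto simp: irreducible_constituents_def)
  have theta_iso: "\<not> gmodule_isomorphic G (\<theta> j) (\<theta> k)" if "j < l" "k < l" "j \<noteq> k" for j k
    using const that by (auto simp: irreducible_constituents_def)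
  have theta_module: "Module.module real_scalars (\<theta> j)" if "j < l" for j
    using const that by (auto simp: irreducible_constituents_def irreducible_gmodule_def is_gmodule_def)
  have "\<forall>j i. \<exists>\<phi>. j < l \<and> i < \<eta> j \<longrightarrow>
      \<phi> \<in> gmodule_iso G (orbit_module G (s j 0)) (orbit_module G (s j i)) \<and> \<phi> (s j 0) = s j i"
    using s(4) by blast
  then obtain \<phi> where \<phi>: "\<And>j i. j < l \<Longrightarrow> i < \<eta> j \<Longrightarrow>
      \<phi> j i \<in> gmodule_iso G (orbit_module G (s j 0)) (orbit_module G (s j i))"
    "\<And>j i. j < l \<Longrightarrow> i < \<eta> j \<Longrightarrow> \<phi> j i (s j 0) = s j i" by metis
  define X where "X = (\<Pi>\<^sub>E (j, i)\<in>?I. orbit_span G (s j i))"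
  define add_all where "add_all x = (\<Sum>p\<in>?I. x p)" for x :: "nat \<times> nat \<Rightarrow> 'n rpoly"
  have inj: "inj_on add_all X"
    and cls: "coinvariant_class \<psi> \<in>
      gmodule_iso G (poly_gmodule\<lparr>carrier := add_all ` X\<rparr>) (coinvariant_algebra \<psi>)"
    using basis unfolding symmetry_adapted_basis_def Let_def add_all_def[abs_def] X_def by auto
  from cls have bij: "bij_betw (coinvariant_class \<psi>) (add_all ` X) (range (coinvariant_class \<psi>))"
    by (simp add: gmodule_iso_def carrier_coinvariant_algebra)
  \<comment> \<open>Members of \<open>X\<close> are extensional, so a tuple has to be restricted to
    the index set.\<close>
  have restr: "restrict x ?I \<in> X" "add_all (restrict x ?I) = (\<Sum>p\<in>?I. x p)"
    if "\<And>j i. j < l \<Longrightarrow> i < \<eta> j \<Longrightarrow> x (j, i) \<in> orbit_span G (s j i)" for x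
    using that by (auto simp: X_def index_set_def add_all_def)
  have "adapted_basis G \<psi> l \<eta> s \<phi>"
  proof unfold_locales
    fix j assume "j < l"
    then show "0 < \<eta> j" by (rule eta)
  next
    fix j i assume "j < l" "i < \<eta> j"
    then show "homogeneous (s j i)" by (rule s(1))
  next
    fix j i assume "j < l" "i < \<eta> j"
    from s(2)[OF this] show "irreducible_subspace G (orbit_span G (s j i))"
      by (rule irreducible_orbit_module)
  next
    fix j i assume "j < l" "i < \<eta> j"
    from \<phi>(1)[OF this] show "equivariant G (orbit_span G (s j 0)) (\<phi> j i)"
      by (simp add: gmodule_iso_orbit_module)
  next
    fix j i assume "j < l" "i < \<eta> j"
    from \<phi>(1)[OF this] show "\<phi> j i ` orbit_span G (s j 0) = orbit_span G (s j i)"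
      by (simp add: gmodule_iso_orbit_module bij_betw_def)
  next
    fix j i assume "j < l" "i < \<eta> j"
    then show "\<phi> j i (s j 0) = s j i" by (rule \<phi>(2))
  next
    fix j k T assume jk: "j < l" "k < l" "j \<noteq> k" and T: "equivariant G (orbit_span G (s j 0)) T"
    show "\<not> bij_betw T (orbit_span G (s j 0)) (orbit_span G (s k 0))"
    proof
      assume "bij_betw T (orbit_span G (s j 0)) (orbit_span G (s k 0))"
      with T have T': "T \<in> gmodule_iso G (orbit_module G (s j 0)) (orbit_module G (s k 0))"
        by (simp add: gmodule_iso_orbit_module)
      obtain f g where f: "f \<in> gmodule_iso G (orbit_module G (s j 0)) (\<theta> j)"
        and g: "g \<in> gmodule_iso G (orbit_module G (s k 0)) (\<theta> k)"
        using s(3)[OF jk(1) eta] s(3)[OF jk(2) eta] jk by (auto simp: gmodule_isomorphic_def)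
      \<comment> \<open>The chain from \<open>\<theta> j\<close> through the two orbit modules to
        \<open>\<theta> k\<close> would be an isomorphism of distinct types.\<close>
      from gmodule_iso_compose[OF gmodule_iso_compose[OF orbit_module_iso_inverse[OF f] T'] g]
      show False using theta_iso[OF jk] by (auto simp: gmodule_isomorphic_def)
    qed
  next
    fix x p
    assume x: "\<And>j i. j < l \<Longrightarrow> i < \<eta> j \<Longrightarrow> x (j, i) \<in> orbit_span G (s j i)"
      and I: "(\<Sum>p\<in>?I. x p) \<in> psi_ideal \<psi>" and p: "p \<in> ?I"
    have x': "restrict x ?I \<in> X" "add_all (restrict x ?I) = (\<Sum>p\<in>?I. x p)"
      by (rule restr; fact x)+
    have z: "restrict (\<lambda>_. 0) ?I \<in> X" "add_all (restrict (\<lambda>_. 0) ?I) = 0"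
      using restr[of "\<lambda>_. 0"] by (simp_all add: subspace_0)
    have "coinvariant_class \<psi> (add_all (restrict x ?I)) = coinvariant_class \<psi> (add_all (restrict (\<lambda>_. 0) ?I))"
      using I unfolding coinvariant_class_eq_iff x'(2) z(2) by simp
    \<comment> \<open>Two injectivities in turn: of the class map on sums, then of the sum map on
      tuples.\<close>
    with bij x'(1) z(1) have "add_all (restrict x ?I) = add_all (restrict (\<lambda>_. 0) ?I)"
      by (meson bij_betw_def imageI inj_onD)
    with inj x'(1) z(1) have "restrict x ?I = restrict (\<lambda>_. 0) ?I" by (meson inj_onD)
    with p show "x p = 0" by (metis restrict_apply')
  next
    fix f
    have "coinvariant_class \<psi> f \<in> coinvariant_class \<psi> ` add_all ` X"
      using bij by (auto simp: bij_betw_def)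
    then obtain x where x: "x \<in> X" "coinvariant_class \<psi> f = coinvariant_class \<psi> (add_all x)" by blast
    then have "f - (\<Sum>p\<in>?I. x p) \<in> psi_ideal \<psi>"
      by (simp add: coinvariant_class_eq_iff add_all_def)
    moreover have "\<forall>j<l. \<forall>i<\<eta> j. x (j, i) \<in> orbit_span G (s j i)"
      using x(1) by (auto simp: X_def PiE_iff index_set_def)
    ultimately show "\<exists>x. (\<forall>j<l. \<forall>i<\<eta> j. x (j, i) \<in> orbit_span G (s j i)) \<and>
        f - (\<Sum>p\<in>?I. x p) \<in> psi_ideal \<psi>" by blast
  next
    fix j assume j: "j < l"
    show "\<exists>b. b ` {..<\<eta> j} \<subseteq> orbit_span G (s j 0) \<and> orbit_span G (s j 0) \<subseteq> span (b ` {..<\<eta> j})"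
      by (rule orbit_span_dimension[OF s(3)[OF j eta[OF j]] theta_module[OF j] dim[OF j]])
  qed
  then show ?thesis by blast
qed


section \<open>Sums of squares matrices\<close>

lemma finite_sum_of_squares:
  assumes "finite K"
  shows "(\<Sum>k\<in>K. (f k)\<^sup>2) \<in> sums_of_squares"
proof -
  obtain h where h: "bij_betw h {0..<card K} K" using ex_bij_betw_nat_finite[OF assms] by blast
  have "(\<Sum>k\<in>K. (f k)\<^sup>2) = (\<Sum>i<card K. (f (h i))\<^sup>2)"
    using sum.reindex_bij_betw[OF h, of "\<lambda>k. (f k)\<^sup>2"] by (simp add: atLeast0LessThan)
  then show ?thesis unfolding sums_of_squares_def by (intro CollectI exI)
qed

lemma gram_matrix_sos:
  assumes X: "finite X" and c: "\<And>x u. c x u \<in> invariants G"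
  shows "Matrix.mat k k (\<lambda>(v, u). \<Sum>x\<in>X. c x v * c x u) \<in> sos_matrices (invariants G) k"
proof -
  let ?n = "card X"
  obtain h where h: "bij_betw h {0..<?n} X" using ex_bij_betw_nat_finite[OF X] by blast
  \<comment> \<open>One row for each element of \<open>X\<close>, and a zero row in addition, since
    \<open>X\<close> may be empty while at least one row is required.\<close>
  define L where "L = Matrix.mat (Suc ?n) k (\<lambda>(r, u). if r < ?n then c (h r) u else 0)"
  have "Matrix.mat k k (\<lambda>(v, u). \<Sum>x\<in>X. c x v * c x u) = transpose_mat L * L"
  proof (rule eq_matI)
    fix v u assume "v < dim_row (transpose_mat L * L)" "u < dim_col (transpose_mat L * L)"
    then have vu: "v < k" "u < k" by (simp_all add: L_def)
    have "(\<Sum>x\<in>X. c x v * c x u) = (\<Sum>r\<in>{0..<?n}. c (h r) v * c (h r) u)"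
      by (rule sum.reindex_bij_betw[OF h, symmetric])
    also have "\<dots> = (\<Sum>r\<in>{0..<Suc ?n}. L $$ (r, v) * L $$ (r, u))"
      using vu by (simp add: L_def)
    also have "\<dots> = (transpose_mat L * L) $$ (v, u)"
      using vu by (simp add: scalar_prod_def L_def)
    finally show "Matrix.mat k k (\<lambda>(v, u). \<Sum>x\<in>X. c x v * c x u) $$ (v, u)
        = (transpose_mat L * L) $$ (v, u)"
      using vu by simp
  qed (simp_all add: L_def)
  moreover have "elements_mat L \<subseteq> invariants G" using c by (auto simp: L_def)
  moreover have "elements_mat (Matrix.mat k k (\<lambda>(v, u). \<Sum>x\<in>X. c x v * c x u)) \<subseteq> invariants G"
    using c by (auto dest!: elements_matD intro!: invariants_sum invariants_mult)
  moreover have "L \<in> carrier_mat (Suc ?n) k" by (simp add: L_def)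
  moreover have "Suc ?n \<ge> 1" by simp
  ultimately show ?thesis
    unfolding sos_matrices_def mem_Collect_eq by (intro conjI exI bexI mat_carrier)
qed

text \<open>Serves both inclusions: \<open>X\<close> consists of the rows of a given factor
  \<open>L\<close> in one, and of pairs of a summand and a basis vector in the other.\<close>

lemma trace_H_matrix:
  assumes A: "A \<in> carrier_mat (\<eta> j) (\<eta> j)"
    and c: "\<And>v u. v < \<eta> j \<Longrightarrow> u < \<eta> j \<Longrightarrow> A $$ (v, u) = (\<Sum>x\<in>X. c x v * c x u)"
  shows "mat_trace (H_matrix G \<eta> s j * A)
    = (\<Sum>x\<in>X. \<Sum>u<\<eta> j. \<Sum>v<\<eta> j. c x u * c x v * reynolds G (s j u * s j v))"
proof -
  have entry: "(H_matrix G \<eta> s j * A) $$ (u, u)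
      = (\<Sum>v<\<eta> j. \<Sum>x\<in>X. c x u * c x v * reynolds G (s j u * s j v))" if u: "u < \<eta> j" for u
  proof -
    have "(H_matrix G \<eta> s j * A) $$ (u, u) = (\<Sum>v<\<eta> j. reynolds G (s j u * s j v) * A $$ (v, u))"
      using A u by (simp add: H_matrix_def scalar_prod_def atLeast0LessThan)
    also have "\<dots> = (\<Sum>v<\<eta> j. \<Sum>x\<in>X. c x u * c x v * reynolds G (s j u * s j v))"
      using u by (intro sum.cong refl) (simp add: c sum_distrib_left ac_simps)
    finally show ?thesis .
  qed
  have "mat_trace (H_matrix G \<eta> s j * A)
      = (\<Sum>u<\<eta> j. \<Sum>v<\<eta> j. \<Sum>x\<in>X. c x u * c x v * reynolds G (s j u * s j v))"
    unfolding mat_trace_def using A by (intro sum.cong entry) (auto simp: H_matrix_def)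
  also have "\<dots> = (\<Sum>u<\<eta> j. \<Sum>x\<in>X. \<Sum>v<\<eta> j. c x u * c x v * reynolds G (s j u * s j v))"
    by (rule sum.cong[OF refl], rule sum.swap)
  also have "\<dots> = (\<Sum>x\<in>X. \<Sum>u<\<eta> j. \<Sum>v<\<eta> j. c x u * c x v * reynolds G (s j u * s j v))"
    by (rule sum.swap)
  finally show ?thesis .
qed

lemma (in finite_matrix_group) reynolds_sum_square:
  assumes c: "\<And>u. u < n \<Longrightarrow> c u \<in> invariants G"
  shows "reynolds G ((\<Sum>u<n. c u * t u)\<^sup>2) = (\<Sum>u<n. \<Sum>v<n. c u * c v * reynolds G (t u * t v))"
proof -
  have "reynolds G ((c u * t u) * (c v * t v)) = c u * c v * reynolds G (t u * t v)"
    if "u < n" "v < n" for u v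
    using reynolds_mult[OF invariants_mult[OF c c], of u v "t u * t v"] that by (simp add: ac_simps)
  then show ?thesis by (simp add: power2_eq_square sum_product reynolds_sum)
qed

lemma (in finite_matrix_group) trace_sos_matrix:
  assumes A: "\<And>j. j < l \<Longrightarrow> A j \<in> sos_matrices (invariants G) (\<eta> j)"
  shows "(\<Sum>j<l. mat_trace (H_matrix G \<eta> s j * A j)) \<in> sums_of_squares \<inter> invariants G"
proof -
  have "\<exists>m L. L \<in> carrier_mat m (\<eta> j) \<and> elements_mat L \<subseteq> invariants G \<and> A j = transpose_mat L * L"
    if "j < l" for j
    using A[OF that] by (auto simp: sos_matrices_def)
  then obtain m L where L: "\<And>j. j < l \<Longrightarrow> L j \<in> carrier_mat (m j) (\<eta> j)"
    "\<And>j. j < l \<Longrightarrow> elements_mat (L j) \<subseteq> invariants G"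
    "\<And>j. j < l \<Longrightarrow> A j = transpose_mat (L j) * L j" by metis
  define q where "q j r = (\<Sum>u<\<eta> j. L j $$ (r, u) * s j u)" for j r
  have tr: "mat_trace (H_matrix G \<eta> s j * A j) = (\<Sum>r<m j. reynolds G ((q j r)\<^sup>2))" if j: "j < l" for j
  proof -
    have inv: "L j $$ (r, u) \<in> invariants G" if "r < m j" "u < \<eta> j" for r u
      using L(1,2)[OF j] that by blast
    have "mat_trace (H_matrix G \<eta> s j * A j) = (\<Sum>r<m j. \<Sum>u<\<eta> j. \<Sum>v<\<eta> j.
        L j $$ (r, u) * L j $$ (r, v) * reynolds G (s j u * s j v))"
    proof (rule trace_H_matrix)
      show "A j \<in> carrier_mat (\<eta> j) (\<eta> j)" using L(1,3)[OF j] by auto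
      show "A j $$ (v, u) = (\<Sum>r<m j. L j $$ (r, v) * L j $$ (r, u))" if "v < \<eta> j" "u < \<eta> j" for v u
        using L(1)[OF j] that by (simp add: L(3)[OF j] scalar_prod_def atLeast0LessThan)
    qed
    also have "\<dots> = (\<Sum>r<m j. reynolds G ((q j r)\<^sup>2))"
      unfolding q_def using inv by (intro sum.cong refl reynolds_sum_square[symmetric]) auto
    finally show ?thesis .
  qed
  \<comment> \<open>The average of a square is itself a sum of squares, of the translates with the
    factor \<open>1 / card G\<close> drawn inside.\<close>
  define P where "P = (\<lambda>(j, r, B). (1 / sqrt (real (card G))) *\<^sub>R poly_act B (q j r))"
  have "reynolds G ((q j r)\<^sup>2) = (\<Sum>B\<in>G. (P (j, r, B))\<^sup>2)" for j r
    using card_G by (simp add: P_def reynolds_def poly_act_power scaleR_sum_right power2_eq_square poly_act_mult)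
  then have "(\<Sum>j<l. mat_trace (H_matrix G \<eta> s j * A j)) = (\<Sum>j<l. \<Sum>r<m j. \<Sum>B\<in>G. (P (j, r, B))\<^sup>2)"
    by (simp add: tr)
  also have "\<dots> = (\<Sum>x\<in>(SIGMA j:{..<l}. {..<m j} \<times> G). (P x)\<^sup>2)"
    by (simp add: sum.Sigma sum.cartesian_product finite_G case_prod_unfold)
  also have "\<dots> \<in> sums_of_squares"
    by (rule finite_sum_of_squares) (simp add: finite_G)
  finally have "(\<Sum>j<l. mat_trace (H_matrix G \<eta> s j * A j)) \<in> sums_of_squares" .
  moreover have "(\<Sum>j<l. mat_trace (H_matrix G \<eta> s j * A j)) \<in> invariants G"
    by (intro invariants_sum) (simp add: tr invariants_sum reynolds_invariant)
  ultimately show ?thesis by blast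
qed

lemma (in adapted_basis) invariant_sum_of_squares:
  assumes g: "g \<in> sums_of_squares" "g \<in> invariants G"
  shows "\<exists>A. (\<forall>j<l. A j \<in> sos_matrices (invariants G) (\<eta> j)) \<and>
    g = (\<Sum>j<l. mat_trace (H_matrix G \<eta> s j * A j))"
proof -
  obtain k and q where q: "g = (\<Sum>i<(k::nat). (q i)\<^sup>2)" using g(1) by (auto simp: sums_of_squares_def)
  have "\<forall>i. \<exists>c. (\<forall>j u e. c j u e \<in> invariants G) \<and> reynolds G ((q i)\<^sup>2)
      = (\<Sum>j<l. \<Sum>e\<in>onb j. \<Sum>u<\<eta> j. \<Sum>v<\<eta> j. c j u e * c j v e * reynolds G (s j u * s j v))"
  proof
    fix i show "\<exists>c. (\<forall>j u e. c j u e \<in> invariants G) \<and> reynolds G ((q i)\<^sup>2)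
      = (\<Sum>j<l. \<Sum>e\<in>onb j. \<Sum>u<\<eta> j. \<Sum>v<\<eta> j. c j u e * c j v e * reynolds G (s j u * s j v))"
      by (rule reynolds_square[of "q i"]) blast
  qed
  from choice[OF this] obtain c where c: "c i j u e \<in> invariants G"
    "reynolds G ((q i)\<^sup>2) = (\<Sum>j<l. \<Sum>e\<in>onb j. \<Sum>u<\<eta> j. \<Sum>v<\<eta> j.
      c i j u e * c i j v e * reynolds G (s j u * s j v))" for i j u e by blast
  \<comment> \<open>A row of the factor is indexed by a pair: the square \<open>i\<close> of
    \<open>g\<close> and a vector \<open>e\<close> of \<open>onb j\<close>.\<close>
  define d where "d j x u = c (fst x) j u (snd x)" for j x u
  define A where "A j = Matrix.mat (\<eta> j) (\<eta> j)
    (\<lambda>(v, u). \<Sum>x\<in>{..<k} \<times> onb j. d j x v * d j x u)" for j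
  have "A j \<in> sos_matrices (invariants G) (\<eta> j)" for j
    unfolding A_def by (rule gram_matrix_sos) (simp_all add: finite_onb d_def c)
  moreover have "g = (\<Sum>j<l. mat_trace (H_matrix G \<eta> s j * A j))"
  proof -
    have tr: "mat_trace (H_matrix G \<eta> s j * A j) = (\<Sum>i<k. \<Sum>e\<in>onb j. \<Sum>u<\<eta> j. \<Sum>v<\<eta> j.
        c i j u e * c i j v e * reynolds G (s j u * s j v))" for j
    proof -
      have "mat_trace (H_matrix G \<eta> s j * A j) = (\<Sum>x\<in>{..<k} \<times> onb j. \<Sum>u<\<eta> j. \<Sum>v<\<eta> j.
          d j x u * d j x v * reynolds G (s j u * s j v))"
        by (rule trace_H_matrix) (simp_all add: A_def)
      then show ?thesis by (simp add: d_def sum.cartesian_product')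
    qed
    \<comment> \<open>The single squares need not be invariant; averaging the whole sum changes
      nothing but replaces each of them by its average.\<close>
    have "g = reynolds G g" using g(2) by (simp add: reynolds_of_invariant)
    also have "\<dots> = (\<Sum>i<k. \<Sum>j<l. \<Sum>e\<in>onb j. \<Sum>u<\<eta> j. \<Sum>v<\<eta> j.
        c i j u e * c i j v e * reynolds G (s j u * s j v))"
      by (simp add: q reynolds_sum c(2))
    also have "\<dots> = (\<Sum>j<l. mat_trace (H_matrix G \<eta> s j * A j))"
      unfolding tr by (rule sum.swap)
    finally show ?thesis .
  qed
  ultimately show ?thesis by blast
qed

theorem theorem2p23:
  fixes G :: "(real^'n^'n) set"
    and \<psi> :: "'n \<Rightarrow> 'n rpoly"
    and l :: nat
    and \<theta> :: "nat \<Rightarrow> (real^'n^'n, 'w) gmodule"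
    and \<eta> :: "nat \<Rightarrow> nat"
    and s :: "nat \<Rightarrow> nat \<Rightarrow> 'n rpoly"
  assumes "finite_reflection_group G"
    and "fundamental_invariants G \<psi>"
    and "irreducible_constituents G (coinvariant_algebra \<psi>) l \<theta> \<eta>"
    and "\<And>j. j < l \<Longrightarrow> has_dimension (\<theta> j) (\<eta> j)"
    and "symmetry_adapted_basis G \<psi> l \<theta> \<eta> s"
  shows "sums_of_squares \<inter> invariants G =
    {g \<in> generated_algebra \<psi>.
       \<exists>A. (\<forall>j<l. A j \<in> sos_matrices (generated_algebra \<psi>) (\<eta> j)) \<and>
           g = (\<Sum>j<l. mat_trace (H_matrix G \<eta> s j * A j))}"
proof -
  have "\<exists>\<phi>. adapted_basis G \<psi> l \<eta> s \<phi>"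
    using assms by (rule adapted_basis_of_symmetry_adapted)
  then obtain \<phi> where "adapted_basis G \<psi> l \<eta> s \<phi>" by (rule exE)
  then interpret adapted_basis G \<psi> l \<eta> s \<phi> .
  show ?thesis
    unfolding generated_algebra_eq
  proof (intro equalityI subsetI)
    fix g assume "g \<in> sums_of_squares \<inter> invariants G"
    with invariant_sum_of_squares[of g]
    show "g \<in> {g \<in> invariants G. \<exists>A. (\<forall>j<l. A j \<in> sos_matrices (invariants G) (\<eta> j)) \<and>
        g = (\<Sum>j<l. mat_trace (H_matrix G \<eta> s j * A j))}" by simp
  next
    fix g assume "g \<in> {g \<in> invariants G. \<exists>A. (\<forall>j<l. A j \<in> sos_matrices (invariants G) (\<eta> j)) \<and>
        g = (\<Sum>j<l. mat_trace (H_matrix G \<eta> s j * A j))}"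
    then obtain A where A: "\<And>j. j < l \<Longrightarrow> A j \<in> sos_matrices (invariants G) (\<eta> j)"
      "g = (\<Sum>j<l. mat_trace (H_matrix G \<eta> s j * A j))" by blast
    show "g \<in> sums_of_squares \<inter> invariants G"
      unfolding A(2) by (rule trace_sos_matrix) (rule A(1))
  qed
qed

end
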